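(* Let $S_0=0$, $S_n=X_1+\cdots+X_n$ for $n\ge 1$, and $M_\infty=\max\{S_k+\xi_k:k\ge 0\}$. Suppose that either (i) $((X_{j+1},\xi_j):j\ge 0)$ is a sequence of i.i.d. random vectors, or (ii) $(X_j:j\ge 1)$ is a sequence of i.i.d. random variables that is independent of the stationary sequence $(\xi_j:j\ge 0)$. Assume, in either case, that there exist positive constants $\theta^*$ and $\varepsilon$ such that $\mathbb{E}\exp(\theta X_1)<\infty$ for $|\theta-\theta^*|<\varepsilon$ and $\mathbb{E}\exp(\theta^*X_1)=1$, and that $X_1$ has a nonlattice distribution. Suppose, in addition, that there exists $c_0<\infty$ such that $\mathbb{P}(X_1>c_0)>0$ and $\mathbb{P}(\xi_0\le c_0)=1$. Then there exists a positive constant $c$ such that $$\mathbb{P}(M_\infty>x)\sim c\exp(-\theta^*x)\qquad\text{as } x\to\infty.$$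
   Context: All random variables are real-valued. $f(x)\sim g(x)$ as $x\to\infty$ means $f(x)/g(x)\to 1$. In case (i), $X_{j+1}$ and $\xi_j$ may be dependent for the same $j$. *)

theory Defs
  imports "HOL-Probability.Probability" "HOL-Library.Landau_Symbols"
begin

definition (in prob_space) iid_vars :: "'b measure \<Rightarrow> ('i \<Rightarrow> 'a \<Rightarrow> 'b) \<Rightarrow> 'i set \<Rightarrow> bool" where
  "iid_vars N Y I \<longleftrightarrow>
     indep_vars (\<lambda>_. N) Y I \<and> (\<forall>i\<in>I. \<forall>j\<in>I. distr M N (Y i) = distr M N (Y j))"

text \<open>Strict stationarity: the law of the whole path on \<open>\<real>\<^sup>\<nat>\<close> is invariant under all time shifts.\<close>

definition (in prob_space) stationary_seq :: "(nat \<Rightarrow> 'a \<Rightarrow> real) \<Rightarrow> bool" where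
  "stationary_seq Y \<longleftrightarrow>
     (\<forall>j. random_variable borel (Y j)) \<and>
     (\<forall>k. distr M (PiM UNIV (\<lambda>_. borel)) (\<lambda>\<omega> j. Y (j + k) \<omega>) =
          distr M (PiM UNIV (\<lambda>_. borel)) (\<lambda>\<omega> j. Y j \<omega>))"

text \<open>Nonlattice in the sense of renewal theory: the law is not carried by \<open>d\<int>\<close> for any
  \<open>d > 0\<close>. Not being carried by any shifted lattice \<open>a + d\<int>\<close> is a stronger property, so
  results assuming the notion below hold under that convention as well.\<close>

definition (in prob_space) nonlattice :: "('a \<Rightarrow> real) \<Rightarrow> bool" where
  "nonlattice Y \<longleftrightarrow> \<not> (\<exists>d>0. prob {\<omega> \<in> space M. \<exists>k::int. Y \<omega> = d * of_int k} = 1)"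

text \<open>The increments are \<open>X 1, X 2, \<dots>\<close>; the value \<open>X 0\<close> is never used.\<close>

definition walk :: "(nat \<Rightarrow> 'a \<Rightarrow> real) \<Rightarrow> nat \<Rightarrow> 'a \<Rightarrow> real" where
  "walk X n \<omega> = (\<Sum>j=1..n. X j \<omega>)"

text \<open>The maximum over all times is taken as a supremum in the extended reals, which agrees
  with the maximum wherever the latter exists.\<close>

definition perturbed_max :: "(nat \<Rightarrow> 'a \<Rightarrow> real) \<Rightarrow> (nat \<Rightarrow> 'a \<Rightarrow> real) \<Rightarrow> 'a \<Rightarrow> ereal" where
  "perturbed_max X \<xi> \<omega> = (SUP k. ereal (walk X k \<omega> + \<xi> k \<omega>))"

definition (in prob_space) iid_pairs_case ::
    "(nat \<Rightarrow> 'a \<Rightarrow> real) \<Rightarrow> (nat \<Rightarrow> 'a \<Rightarrow> real) \<Rightarrow> bool" where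
  "iid_pairs_case X \<xi> \<longleftrightarrow>
     iid_vars (borel :: (real \<times> real) measure) (\<lambda>j \<omega>. (X (Suc j) \<omega>, \<xi> j \<omega>)) UNIV"

definition (in prob_space) indep_stationary_case ::
    "(nat \<Rightarrow> 'a \<Rightarrow> real) \<Rightarrow> (nat \<Rightarrow> 'a \<Rightarrow> real) \<Rightarrow> bool" where
  "indep_stationary_case X \<xi> \<longleftrightarrow>
     iid_vars borel X {1..} \<and>
     stationary_seq \<xi> \<and>
     indep_var (PiM {1..} (\<lambda>_. borel)) (\<lambda>\<omega>. \<lambda>j\<in>{1..}. X j \<omega>)
               (PiM UNIV (\<lambda>_. borel)) (\<lambda>\<omega> j. \<xi> j \<omega>)"

end

theory Submission
  imports Defs
begin

text \<open>
  Removing the first step gives \<open>M\<^sub>\<infinity> = max \<xi>\<^sub>0 (X\<^sub>1 + M')\<close> with \<open>M'\<close> distributed as \<open>M\<^sub>\<infinity>\<close> and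
  independent of \<open>X\<^sub>1\<close>, in either case. After smoothing the
  indicator of \<open>M\<^sub>\<infinity> > t\<close> to a ramp, \<open>h t = exp (\<theta> t) E (ramp (M\<^sub>\<infinity> - t))\<close> is bounded (Lundberg's inequality)
  and Lipschitz, tends to \<open>0\<close> at \<open>-\<infinity>\<close>, and satisfies \<open>h = T h + z\<close>, where \<open>T\<close> averages over a step of the
  walk with the exponentially tilted law, \<open>z \<ge> 0\<close>, and \<open>z t = 0\<close> for \<open>t \<ge> c\<^sub>0\<close>. That \<open>h\<close> converges to a
  positive limit replaces the key renewal theorem and is shown directly.

  The mean square increment \<open>D\<close> of \<open>h\<close> over one step satisfies \<open>D = T h\<^sup>2 - h\<^sup>2\<close> and \<open>D \<le> T D\<close> up to errors
  that vanish at \<open>+\<infinity>\<close>. Hence \<open>n D \<le> sup h\<^sup>2 + o(1)\<close> for every \<open>n\<close>, so \<open>D\<close> tends to \<open>0\<close>, and since the step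
  is nonlattice, \<open>h (t - a) - h t\<close> tends to \<open>0\<close> for every \<open>a\<close>. The integrated renewal equation then
  identifies the limit of \<open>h\<close>; if it were \<open>0\<close>, \<open>h\<close> would be harmonic, hence constant, hence \<open>0\<close>.
\<close>

section \<open>A renewal theorem for nonlattice steps with positive mean\<close>

text \<open>If \<open>G\<close> has arbitrarily small positive elements, their integer multiples are
  dense, and closedness gives everything. Otherwise division with remainder by the least positive
  element shows that this element generates \<open>G\<close>.\<close>

lemma closed_real_subgroup_cases:
  fixes G :: "real set"
  assumes cl: "closed G" and zero: "0 \<in> G" and diff: "\<And>a b. a \<in> G \<Longrightarrow> b \<in> G \<Longrightarrow> a - b \<in> G"
  shows "G = UNIV \<or> (\<exists>d>0. G \<subseteq> range (\<lambda>k::int. d * of_int k))"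
proof -
  have neg: "- a \<in> G" if "a \<in> G" for a using diff[OF zero that] by simp
  have add: "a + b \<in> G" if "a \<in> G" "b \<in> G" for a b using diff[OF that(1) neg[OF that(2)]] by simp
  have natmul: "of_nat n * a \<in> G" if "a \<in> G" for a n
    by (induction n) (use zero add that in \<open>auto simp: algebra_simps\<close>)
  have intmul: "of_int k * a \<in> G" if "a \<in> G" for a k
    by (cases k rule: int_cases2) (use natmul[OF that] neg in auto)
  show ?thesis
  proof (cases "\<forall>e>0. \<exists>g\<in>G. 0 < g \<and> g < e")
    case True
    have "x \<in> closure G" for x
      unfolding closure_approachable
    proof (intro allI impI)
      fix e :: real assume "e > 0"
      then obtain g where g: "g \<in> G" "0 < g" "g < e" using True by blast
      have "\<bar>of_int \<lfloor>x / g\<rfloor> * g - x\<bar> < e"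
        using g floor_divide_lower[OF g(2), of x] floor_divide_upper[OF g(2), of x] 
        by (auto simp: algebra_simps abs_less_iff)
      then show "\<exists>y\<in>G. dist y x < e" using intmul[OF g(1)] by (auto simp: dist_real_def)
    qed
    then have "G = UNIV" using cl by auto
    then show ?thesis ..
  next
    case False
    then obtain e where e: "e > 0" "\<And>g. g \<in> G \<Longrightarrow> 0 < g \<Longrightarrow> e \<le> g" by (meson not_less)
    show ?thesis
    proof (cases "\<exists>g\<in>G. 0 < g")
      case True
      \<comment> \<open>No element of \<open>G\<close> lies strictly between 0 and \<open>e\<close>,
        so \<open>?P\<close> consists of all positive elements of \<open>G\<close>. Being closed, it
        contains its infimum \<open>d\<close>.\<close>
      let ?P = "G \<inter> {e..}"
      have ne: "?P \<noteq> {}" using True e by auto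
      have bb: "bdd_below ?P" by auto
      define d where "d = Inf ?P"
      have d: "d \<in> ?P" unfolding d_def by (rule closed_contains_Inf[OF ne bb]) (use cl in auto)
      have dle: "d \<le> g" if "g \<in> G" "0 < g" for g
        unfolding d_def by (rule cInf_lower) (use that e bb in auto)
      have dpos: "d > 0" using d e by auto
      have "g = d * of_int \<lfloor>g / d\<rfloor>" if "g \<in> G" for g
      proof -
        let ?r = "g - of_int \<lfloor>g / d\<rfloor> * d"
        have "?r \<in> G" using diff intmul d that by blast
        moreover have "0 \<le> ?r" "?r < d"
          using floor_divide_lower[OF dpos, of g] floor_divide_upper[OF dpos, of g] by (auto simp: algebra_simps)
        ultimately have "?r = 0" using dle[of ?r] by linarith
        then show ?thesis by (simp add: algebra_simps)
      qed
      then have "G \<subseteq> range (\<lambda>k::int. d * of_int k)" by blast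
      then show ?thesis using dpos by blast
    next
      case False
      then have "G \<subseteq> {0}" using neg by (metis insertI1 linorder_neqE_linordered_idom neg_0_less_iff_less subsetI)
      \<comment> \<open>\<open>G\<close> is trivial here, so any \<open>d > 0\<close> serves; 1 is
        an arbitrary choice.\<close>
      then have "G \<subseteq> range (\<lambda>k::int. 1 * of_int k)" by auto
      then show ?thesis using zero_less_one by blast
    qed
  qed
qed

section \<open>Bounded Borel functions and averaging over one step\<close>

definition bounded_borel :: "(real \<Rightarrow> real) \<Rightarrow> bool" where
  "bounded_borel f \<longleftrightarrow> f \<in> borel_measurable borel \<and> (\<exists>C. \<forall>x. \<bar>f x\<bar> \<le> C)"

lemma bounded_borelI: "f \<in> borel_measurable borel \<Longrightarrow> (\<And>x. \<bar>f x\<bar> \<le> C) \<Longrightarrow> bounded_borel f"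
  unfolding bounded_borel_def by blast

lemma bounded_borelD: "bounded_borel f \<Longrightarrow> f \<in> borel_measurable borel"
  unfolding bounded_borel_def by blast

lemma bounded_borelE:
  assumes "bounded_borel f" obtains C where "\<And>x. \<bar>f x\<bar> \<le> C"
  using assms unfolding bounded_borel_def by blast

lemma bounded_borel_const [simp]: "bounded_borel (\<lambda>x. c)"
  by (rule bounded_borelI[of _ "\<bar>c\<bar>"]) auto

lemma bounded_borel_add:
  assumes "bounded_borel f" "bounded_borel g" shows "bounded_borel (\<lambda>x. f x + g x)"
proof -
  note [measurable] = assms[THEN bounded_borelD]
  obtain C D where "\<And>x. \<bar>f x\<bar> \<le> C" "\<And>x. \<bar>g x\<bar> \<le> D" using assms by (meson bounded_borelE)
  then show ?thesis
    by (intro bounded_borelI[of _ "C + D"]) (auto intro!: abs_triangle_ineq[THEN order_trans] add_mono)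
qed

lemma bounded_borel_mult:
  assumes "bounded_borel f" "bounded_borel g" shows "bounded_borel (\<lambda>x. f x * g x)"
proof -
  note [measurable] = assms[THEN bounded_borelD]
  obtain C D where CD: "\<And>x. \<bar>f x\<bar> \<le> C" "\<And>x. \<bar>g x\<bar> \<le> D" using assms by (meson bounded_borelE)
  moreover have "0 \<le> C" using CD(1)[of 0] by linarith
  ultimately show ?thesis
    by (intro bounded_borelI[of _ "C * D"]) (auto simp: abs_mult intro!: mult_mono)
qed

lemma bounded_borel_abs: assumes "bounded_borel f" shows "bounded_borel (\<lambda>x. \<bar>f x\<bar>)"
proof -
  note [measurable] = assms[THEN bounded_borelD]
  obtain C where "\<And>x. \<bar>f x\<bar> \<le> C" using assms by (meson bounded_borelE)
  then show ?thesis by (intro bounded_borelI[of _ C]) auto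
qed

lemma bounded_borel_diff: "bounded_borel f \<Longrightarrow> bounded_borel g \<Longrightarrow> bounded_borel (\<lambda>x. f x - g x)"
  using bounded_borel_add[of f "\<lambda>x. -1 * g x"] bounded_borel_mult[of "\<lambda>x. -1" g] by simp

context real_distribution
begin

text \<open>Convolution with the step law \<open>M\<close>, the operator \<open>T\<close> of the
  overview.\<close>

definition avg :: "(real \<Rightarrow> real) \<Rightarrow> real \<Rightarrow> real" where
  "avg f x = (\<integral>a. f (x - a) \<partial>M)"

lemma integrable_bounded_borel: assumes "bounded_borel f" shows "integrable M f"
proof -
  note [measurable] = assms[THEN bounded_borelD]
  obtain C where "\<And>x. \<bar>f x\<bar> \<le> C" using assms by (meson bounded_borelE)
  then show ?thesis by (intro integrable_const_bound[of _ C]) auto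
qed

lemma bounded_borel_shift:
  assumes "bounded_borel f" shows "bounded_borel (\<lambda>a. f (x - a))"
proof -
  note [measurable] = assms[THEN bounded_borelD]
  obtain C where "\<And>x. \<bar>f x\<bar> \<le> C" using assms by (meson bounded_borelE)
  then show ?thesis by (intro bounded_borelI[of _ C]) auto
qed

lemma integrable_shift: "bounded_borel f \<Longrightarrow> integrable M (\<lambda>a. f (x - a))"
  by (intro integrable_bounded_borel bounded_borel_shift)

lemma avg_bound:
  assumes "bounded_borel f" "\<And>x. \<bar>f x\<bar> \<le> C" shows "\<bar>avg f x\<bar> \<le> C"
proof -
  have "\<bar>avg f x\<bar> \<le> (\<integral>a. \<bar>f (x - a)\<bar> \<partial>M)" unfolding avg_def by (rule integral_abs_bound)
  also have "\<dots> \<le> (\<integral>a. C \<partial>M)"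
    by (rule integral_mono) (use assms integrable_shift[OF bounded_borel_abs] in auto)
  finally show ?thesis using prob_space by simp
qed

lemma bounded_borel_avg: assumes "bounded_borel f" shows "bounded_borel (avg f)"
proof -
  note [measurable] = bounded_borelD[OF assms]
  obtain C where "\<And>x. \<bar>f x\<bar> \<le> C" using assms by (meson bounded_borelE)
  then show ?thesis
    by (intro bounded_borelI[of _ C] avg_bound assms) (auto simp: avg_def[abs_def])
qed

lemma avg_add: "bounded_borel f \<Longrightarrow> bounded_borel g \<Longrightarrow> avg (\<lambda>x. f x + g x) x = avg f x + avg g x"
  unfolding avg_def by (intro Bochner_Integration.integral_add integrable_shift)

lemma avg_diff: "bounded_borel f \<Longrightarrow> bounded_borel g \<Longrightarrow> avg (\<lambda>x. f x - g x) x = avg f x - avg g x"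
  unfolding avg_def by (intro Bochner_Integration.integral_diff integrable_shift)

lemma avg_const [simp]: "avg (\<lambda>x. c) = (\<lambda>x. c)"
  unfolding avg_def using prob_space by auto

lemma avg_mono: "bounded_borel f \<Longrightarrow> bounded_borel g \<Longrightarrow> (\<And>x. f x \<le> g x) \<Longrightarrow> avg f x \<le> avg g x"
  unfolding avg_def by (intro integral_mono integrable_shift)

lemma bounded_borel_funpow_avg: "bounded_borel f \<Longrightarrow> bounded_borel ((avg ^^ n) f)"
  by (induction n) (auto intro: bounded_borel_avg)

text \<open>Dominated convergence: for a fixed step \<open>a\<close>, the argument
  \<open>x - a\<close> tends to infinity with \<open>x\<close>, and \<open>f\<close> is
  bounded.\<close>

lemma tendsto_avg:
  assumes f: "bounded_borel f" and lim: "(f \<longlongrightarrow> l) at_top"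
  shows "(avg f \<longlongrightarrow> l) at_top"
proof -
  note [measurable] = bounded_borelD[OF f]
  obtain C where C: "\<And>x. \<bar>f x\<bar> \<le> C" using f by (meson bounded_borelE)
  have "((\<lambda>x. \<integral>a. f (x - a) \<partial>M) \<longlongrightarrow> (\<integral>a. l \<partial>M)) at_top"
  proof (rule integral_dominated_convergence_at_top[where w="\<lambda>_. C"])
    show "AE a in M. ((\<lambda>x. f (x - a)) \<longlongrightarrow> l) at_top"
    proof (rule AE_I2)
      fix a
      have "filterlim (\<lambda>x. x - a) at_top (at_top :: real filter)"
        using filterlim_tendsto_add_at_top[OF tendsto_const[of "-a"] filterlim_ident] by simp
      then show "((\<lambda>x. f (x - a)) \<longlongrightarrow> l) at_top" by (rule filterlim_compose[OF lim])
    qed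
  qed (use C in auto)
  then show ?thesis using prob_space by (simp add: avg_def[abs_def])
qed

section \<open>The mean square increment over one step (\<open>D\<close> in the overview)\<close>

definition sqinc :: "(real \<Rightarrow> real) \<Rightarrow> real \<Rightarrow> real" where
  "sqinc h x = (\<integral>a. (h (x - a) - h x)\<^sup>2 \<partial>M)"

text \<open>Expanding the square. The last term is the error made because \<open>h\<close> need not
  be harmonic, that is, \<open>h - avg h\<close> need not vanish.\<close>

lemma sqinc_eq:
  assumes h: "bounded_borel h"
  shows "sqinc h x = avg (\<lambda>x. h x * h x) x - h x * h x + 2 * h x * (h x - avg h x)"
proof -
  have hh: "bounded_borel (\<lambda>x. h x * h x)" using h h by (rule bounded_borel_mult)
  have "sqinc h x = (\<integral>a. h (x - a) * h (x - a) - 2 * h x * h (x - a) + h x * h x \<partial>M)"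
    unfolding sqinc_def by (intro Bochner_Integration.integral_cong) (auto simp: power2_eq_square algebra_simps)
  also have "\<dots> = avg (\<lambda>x. h x * h x) x - 2 * h x * avg h x + h x * h x"
    unfolding avg_def using integrable_shift[OF h] integrable_shift[OF hh] prob_space by simp
  finally show ?thesis by (simp add: algebra_simps)
qed

lemma bounded_borel_sqinc: assumes h: "bounded_borel h" shows "bounded_borel (sqinc h)"
proof -
  have "sqinc h = (\<lambda>x. avg (\<lambda>x. h x * h x) x - h x * h x + 2 * h x * (h x - avg h x))"
    using sqinc_eq[OF h] by blast
  then show ?thesis
    using h by (simp add: bounded_borel_add bounded_borel_diff bounded_borel_mult bounded_borel_avg)
qed

text \<open>The difference of the two sides is the variance of \<open>f\<close>.\<close>

lemma sq_integral_le:
  assumes "bounded_borel f" shows "(\<integral>a. f a \<partial>M)\<^sup>2 \<le> (\<integral>a. (f a)\<^sup>2 \<partial>M)"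
proof -
  have 1: "integrable M f" using assms by (rule integrable_bounded_borel)
  have 2: "integrable M (\<lambda>a. (f a)\<^sup>2)"
    unfolding power2_eq_square using assms by (intro integrable_bounded_borel bounded_borel_mult)
  have "0 \<le> variance f" by simp
  then show ?thesis using variance_eq[OF 1 2] by simp
qed

text \<open>Averaging over a second, independent step: conditional Jensen, up to the defect
  \<open>h - avg h\<close>.\<close>

lemma sqinc_le_avg_sqinc:
  assumes h: "bounded_borel h" and C: "\<And>x. \<bar>h x\<bar> \<le> C"
  defines "z \<equiv> \<lambda>x. \<bar>h x - avg h x\<bar>"
  shows "sqinc h x \<le> avg (sqinc h) x + 8 * C * (avg z x + z x)"
proof -
  note [measurable] = bounded_borelD[OF h]
  have ah: "bounded_borel (avg h)" using h by (rule bounded_borel_avg)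
  note [measurable] = bounded_borelD[OF ah]
  have z: "bounded_borel z" unfolding z_def using h ah by (intro bounded_borel_abs bounded_borel_diff)
  have C0: "0 \<le> C" using C[of 0] by linarith
  \<comment> \<open>The increment of \<open>avg h\<close> in place of that of \<open>h\<close>;
    exchanging the two changes the increment by at most \<open>z (x - a) + z x\<close>.\<close>
  define p where "p a = avg h (x - a) - avg h x" for a
  have pb: "\<bar>p a\<bar> \<le> 2 * C" for a
    using avg_bound[OF h C, of "x - a"] avg_bound[OF h C, of x] by (auto simp: p_def)
  have [measurable]: "p \<in> borel_measurable borel" unfolding p_def[abs_def] by measurable
  have step: "(h (x - a) - h x)\<^sup>2 \<le> (p a)\<^sup>2 + 8 * C * (z (x - a) + z x)" for a
  proof -
    let ?d = "h (x - a) - h x"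
    \<comment> \<open>Difference of squares: the first factor is small, the second is at most
      \<open>4 * C\<close>, so \<open>8 * C\<close> leaves room.\<close>
    have "?d\<^sup>2 - (p a)\<^sup>2 = (?d - p a) * (?d + p a)" by (simp add: power2_eq_square algebra_simps)
    also have "\<dots> \<le> \<bar>?d - p a\<bar> * \<bar>?d + p a\<bar>" by (metis abs_ge_self abs_mult)
    also have "\<dots> \<le> (z (x - a) + z x) * (8 * C)"
    proof (rule mult_mono)
      show "\<bar>?d - p a\<bar> \<le> z (x - a) + z x" by (simp add: z_def p_def)
      show "\<bar>?d + p a\<bar> \<le> 8 * C" using C[of "x - a"] C[of x] pb[of a] C0 by linarith
    qed (auto simp: z_def)
    finally show ?thesis by (simp add: algebra_simps)
  qed
  have ip: "integrable M (\<lambda>a. (p a)\<^sup>2)"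
    unfolding power2_eq_square
    by (intro integrable_bounded_borel bounded_borel_mult bounded_borelI[of p "2 * C"] pb) measurable
  have "bounded_borel (\<lambda>y. (h y - h x) * (h y - h x))"
    using h by (intro bounded_borel_mult bounded_borel_diff bounded_borel_const)
  from integrable_shift[OF this, of x] have i1: "integrable M (\<lambda>a. (h (x - a) - h x)\<^sup>2)"
    by (simp add: power2_eq_square)
  have "sqinc h x \<le> (\<integral>a. (p a)\<^sup>2 + 8 * C * (z (x - a) + z x) \<partial>M)"
    unfolding sqinc_def using step ip integrable_shift[OF z, of x] i1 by (intro integral_mono) auto
  also have "\<dots> = (\<integral>a. (p a)\<^sup>2 \<partial>M) + 8 * C * (avg z x + z x)"
    using ip integrable_shift[OF z, of x] prob_space by (simp add: avg_def)
  \<comment> \<open>\<open>p a\<close> is the mean over an independent step \<open>b\<close> of the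
    increment of \<open>h\<close> from \<open>x - b\<close> to \<open>x - b - a\<close>. Jensen
    moves the square inside this mean, and Fubini then lets \<open>a\<close> be integrated first,
    which produces \<open>sqinc h (x - b)\<close>.\<close>
  also have "(\<integral>a. (p a)\<^sup>2 \<partial>M) \<le> avg (sqinc h) x"
  proof -
    interpret P: pair_prob_space M M ..
    have bd: "\<bar>(h (x - a - b) - h (x - b))\<^sup>2\<bar> \<le> (2*C)\<^sup>2" for a b
    proof -
      have "\<bar>h (x - a - b) - h (x - b)\<bar> \<le> \<bar>2*C\<bar>" using C[of "x-a-b"] C[of "x-b"] C0 by linarith
      then show ?thesis by (simp add: abs_le_square_iff)
    qed
    have int2: "integrable (M \<Otimes>\<^sub>M M) (\<lambda>(a, b). (h (x - a - b) - h (x - b))\<^sup>2)"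
      by (rule P.integrable_const_bound[of _ "(2*C)\<^sup>2"]) (use bd in auto)
    have "(p a)\<^sup>2 \<le> (\<integral>b. (h (x - a - b) - h (x - b))\<^sup>2 \<partial>M)" for a
    proof -
      have "p a = (\<integral>b. h (x - a - b) - h (x - b) \<partial>M)"
        unfolding p_def avg_def by (rule Bochner_Integration.integral_diff[symmetric]) (rule integrable_shift[OF h])+
      also have "\<dots>\<^sup>2 \<le> (\<integral>b. (h (x - a - b) - h (x - b))\<^sup>2 \<partial>M)"
      proof (rule sq_integral_le, rule bounded_borelI[of _ "2*C"])
        show "\<bar>h (x - a - b) - h (x - b)\<bar> \<le> 2 * C" for b
          using C[of "x-a-b"] C[of "x-b"] by linarith
      qed measurable
      finally show ?thesis .
    qed
    then have "(\<integral>a. (p a)\<^sup>2 \<partial>M) \<le> (\<integral>a. (\<integral>b. (h (x - a - b) - h (x - b))\<^sup>2 \<partial>M) \<partial>M)"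
      using P.integrable_fst[OF int2] ip by (intro integral_mono) auto
    also have "\<dots> = (\<integral>b. (\<integral>a. (h (x - a - b) - h (x - b))\<^sup>2 \<partial>M) \<partial>M)"
      using P.Fubini_integral[OF int2] by simp
    also have "\<dots> = avg (sqinc h) x" unfolding avg_def sqinc_def by (simp add: algebra_simps)
    finally show ?thesis .
  qed
  finally show ?thesis by simp
qed

text \<open>Up to errors, \<open>sqinc h\<close> is at most each of its iterated averages, and the
  sum of the first \<open>n\<close> of these telescopes to a difference of averages of the square of
  \<open>h\<close>, which is at most the square of \<open>C\<close>. The function \<open>w\<close>
  dominates the error of a single step in both arguments.\<close>

lemma sqinc_iterate:
  assumes h: "bounded_borel h" and C: "\<And>x. \<bar>h x\<bar> \<le> C"
  defines "z \<equiv> \<lambda>x. \<bar>h x - avg h x\<bar>"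
  defines "w \<equiv> \<lambda>x. 8 * C * (avg z x + z x)"
  shows "of_nat n * sqinc h x \<le> C\<^sup>2 + (\<Sum>k<n. \<Sum>j\<le>k. (avg ^^ j) w x)"
proof -
  have C0: "0 \<le> C" using C[of 0] by linarith
  have ah: "bounded_borel (avg h)" using h by (rule bounded_borel_avg)
  have z: "bounded_borel z" unfolding z_def using h ah by (intro bounded_borel_abs bounded_borel_diff)
  have w: "bounded_borel w" unfolding w_def using z
    by (intro bounded_borel_mult bounded_borel_add bounded_borel_avg) auto
  have az: "0 \<le> avg z x" for x unfolding avg_def by (rule integral_nonneg_AE) (auto simp: z_def)
  note s = bounded_borel_sqinc[OF h]
  let ?hh = "\<lambda>x. h x * h x"
  have hh: "bounded_borel ?hh" using h h by (rule bounded_borel_mult)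
  note fp = bounded_borel_funpow_avg
  have up: "sqinc h x \<le> avg ?hh x - ?hh x + w x" for x
  proof -
    have "2 * h x * (h x - avg h x) \<le> \<bar>2 * h x * (h x - avg h x)\<bar>" by (rule abs_ge_self)
    also have "\<dots> = 2 * \<bar>h x\<bar> * z x" by (simp add: z_def abs_mult)
    also have "\<dots> \<le> 8 * C * (avg z x + z x)"
      by (rule mult_mono) (use C[of x] az[of x] C0 in \<open>auto simp: z_def\<close>)
    finally show ?thesis unfolding w_def sqinc_eq[OF h] by simp
  qed
  \<comment> \<open>Iteration of \<open>sqinc_le_avg_sqinc\<close>: since \<open>avg\<close> is
    monotone, applying it \<open>k\<close> times preserves the one-step inequality.\<close>
  have A: "sqinc h x \<le> (avg ^^ k) (sqinc h) x + (\<Sum>j<k. (avg ^^ j) w x)" for k x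
  proof (induction k arbitrary: x)
    case (Suc k)
    have *: "bounded_borel (\<lambda>x. avg (sqinc h) x + w x)" using s w by (intro bounded_borel_add bounded_borel_avg)
    have "(avg ^^ k) (sqinc h) x \<le> (avg ^^ k) (\<lambda>x. avg (sqinc h) x + w x) x" for x
    proof (induction k arbitrary: x)
      case 0 show ?case using sqinc_le_avg_sqinc[OF h C] by (simp add: w_def z_def)
    qed (auto intro!: avg_mono fp s *)
    also have "(avg ^^ k) (\<lambda>x. avg (sqinc h) x + w x) x = (avg ^^ Suc k) (sqinc h) x + (avg ^^ k) w x" for x
    proof (induction k arbitrary: x)
      case (Suc k)
      have "(avg ^^ Suc k) (\<lambda>x. avg (sqinc h) x + w x) x
          = avg (\<lambda>x. (avg ^^ Suc k) (sqinc h) x + (avg ^^ k) w x) x"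
        unfolding Suc[THEN ext, symmetric] by simp
      also have "\<dots> = (avg ^^ Suc (Suc k)) (sqinc h) x + (avg ^^ Suc k) w x"
        by (subst avg_add[OF fp[OF s] fp[OF w]]) simp
      finally show ?case .
    qed simp
    finally show ?case using Suc.IH[of x] by (smt (verit) sum.lessThan_Suc)
  qed simp
  \<comment> \<open>The telescoping sum: \<open>up\<close> is averaged \<open>k\<close> times and
    added over \<open>k < n\<close>.\<close>
  have B: "(\<Sum>k<n. (avg ^^ k) (sqinc h) x) \<le> (avg ^^ n) ?hh x - ?hh x + (\<Sum>k<n. (avg ^^ k) w x)" for x
  proof (induction n)
    case (Suc n)
    have *: "bounded_borel (\<lambda>x. avg ?hh x - ?hh x + w x)"
      using hh w by (intro bounded_borel_add bounded_borel_diff bounded_borel_avg)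
    have "(avg ^^ n) (sqinc h) x \<le> (avg ^^ n) (\<lambda>x. avg ?hh x - ?hh x + w x) x" for x
      by (induction n arbitrary: x) (auto intro!: avg_mono fp s * up)
    also have "(avg ^^ n) (\<lambda>x. avg ?hh x - ?hh x + w x) x
        = (avg ^^ Suc n) ?hh x - (avg ^^ n) ?hh x + (avg ^^ n) w x" for x
    proof (induction n arbitrary: x)
      case (Suc n)
      have "(avg ^^ Suc n) (\<lambda>x. avg ?hh x - ?hh x + w x) x
          = avg (\<lambda>x. (avg ^^ Suc n) ?hh x - (avg ^^ n) ?hh x + (avg ^^ n) w x) x"
        unfolding Suc[THEN ext, symmetric] by simp
      also have "\<dots> = (avg ^^ Suc (Suc n)) ?hh x - (avg ^^ Suc n) ?hh x + (avg ^^ Suc n) w x"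
        by (subst avg_add[OF bounded_borel_diff[OF fp[OF hh] fp[OF hh]] fp[OF w]],
            subst avg_diff[OF fp[OF hh] fp[OF hh]]) simp
      finally show ?case .
    qed simp
    finally have "(avg ^^ n) (sqinc h) x \<le> (avg ^^ Suc n) ?hh x - (avg ^^ n) ?hh x + (avg ^^ n) w x" .
    then show ?case using Suc.IH unfolding sum.lessThan_Suc by linarith
  qed simp
  have hhC: "\<bar>h x * h x\<bar> \<le> C\<^sup>2" for x
    using mult_mono[of "\<bar>h x\<bar>" C "\<bar>h x\<bar>" C] C[of x] C0 by (simp add: power2_eq_square)
  have "\<bar>(avg ^^ n) ?hh x\<bar> \<le> C\<^sup>2" for x
  proof (induction n arbitrary: x)
    case (Suc n)
    then show ?case using avg_bound[OF fp[OF hh]] by simp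
  qed (use hhC in simp)
  then have "(avg ^^ n) ?hh x - ?hh x \<le> C\<^sup>2" by (smt (verit) zero_le_square)
  moreover have "of_nat n * sqinc h x \<le> (\<Sum>k<n. (avg ^^ k) (sqinc h) x + (\<Sum>j<k. (avg ^^ j) w x))"
    using sum_mono[of "{..<n}" "\<lambda>_. sqinc h x", OF A] by simp
  \<comment> \<open>For each \<open>k\<close>, the terms with \<open>j < k\<close> are the errors
    from \<open>A\<close>, and the term \<open>j = k\<close> is the error from
    \<open>B\<close>.\<close>
  moreover have "(\<Sum>k<n. \<Sum>j\<le>k. (avg ^^ j) w x)
      = (\<Sum>k<n. \<Sum>j<k. (avg ^^ j) w x) + (\<Sum>k<n. (avg ^^ k) w x)"
    by (simp add: sum.distrib[symmetric] lessThan_Suc_atMost[symmetric])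
  ultimately show ?thesis using B[of x] by (simp add: sum.distrib)
qed

text \<open>For fixed \<open>n\<close> the error sum in \<open>sqinc_iterate\<close> is a finite sum
  of functions vanishing at infinity, so the upper limit of \<open>sqinc h\<close> is at most the
  square of \<open>C\<close> divided by \<open>n\<close>. Only afterwards is \<open>n\<close> taken
  large.\<close>

lemma sqinc_tendsto_0:
  assumes h: "bounded_borel h" and lim: "((\<lambda>x. h x - avg h x) \<longlongrightarrow> 0) at_top"
  shows "(sqinc h \<longlongrightarrow> 0) at_top"
proof -
  obtain C where C: "\<And>x. \<bar>h x\<bar> \<le> C" using h by (meson bounded_borelE)
  define z where "z = (\<lambda>x. \<bar>h x - avg h x\<bar>)"
  define w where "w = (\<lambda>x. 8 * C * (avg z x + z x))"
  have z: "bounded_borel z" unfolding z_def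
    using h by (intro bounded_borel_abs bounded_borel_diff bounded_borel_avg)
  have w: "bounded_borel w" unfolding w_def using z
    by (intro bounded_borel_mult bounded_borel_add bounded_borel_avg) auto
  have z0: "(z \<longlongrightarrow> 0) at_top" unfolding z_def using tendsto_rabs[OF lim] by simp
  have w0: "(w \<longlongrightarrow> 0) at_top" unfolding w_def
    using tendsto_mult[OF tendsto_const[of "8*C"] tendsto_add[OF tendsto_avg[OF z z0] z0]] by simp
  have "((avg ^^ j) w \<longlongrightarrow> 0) at_top" for j
    by (induction j) (auto intro!: tendsto_avg bounded_borel_funpow_avg w w0)
  then have S: "((\<lambda>x. \<Sum>k<n. \<Sum>j\<le>k. (avg ^^ j) w x) \<longlongrightarrow> 0) at_top" for n
    by (intro tendsto_null_sum)
  show ?thesis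
  proof (rule tendstoI)
    fix e :: real assume e: "e > 0"
    \<comment> \<open>The summand 1 is room for the error sum, which falls below 1
      eventually.\<close>
    obtain n :: nat where n: "(C\<^sup>2 + 1) / e < of_nat n" using reals_Archimedean2 by blast
    have npos: "n > 0" using n e by (smt (verit) divide_nonneg_pos of_nat_0_less_iff zero_le_power2)
    have "eventually (\<lambda>x. (\<Sum>k<n. \<Sum>j\<le>k. (avg ^^ j) w x) < 1) at_top"
      using order_tendstoD(2)[OF S, of 1] by simp
    then show "eventually (\<lambda>x. dist (sqinc h x) 0 < e) at_top"
    proof eventually_elim
      case (elim x)
      have "of_nat n * sqinc h x \<le> C\<^sup>2 + (\<Sum>k<n. \<Sum>j\<le>k. (avg ^^ j) w x)"
        unfolding w_def z_def by (rule sqinc_iterate[OF h C])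
      then have "of_nat n * sqinc h x < C\<^sup>2 + 1" using elim by linarith
      also have "\<dots> < of_nat n * e" using n e by (simp add: field_simps)
      finally have "sqinc h x < e" using npos by simp
      moreover have "0 \<le> sqinc h x" unfolding sqinc_def by simp
      ultimately show ?case by simp
    qed
  qed
qed

text \<open>For harmonic \<open>h\<close> all error terms in \<open>sqinc_iterate\<close> are zero,
  so every multiple of \<open>sqinc h x\<close> obeys the same bound.\<close>

lemma sqinc_harmonic:
  assumes h: "bounded_borel h" and eq: "avg h = h"
  shows "sqinc h x = 0"
proof -
  obtain C where C: "\<And>x. \<bar>h x\<bar> \<le> C" using h by (meson bounded_borelE)
  have "(avg ^^ j) (\<lambda>x. 0) = (\<lambda>x. 0)" for j by (induction j) auto
  then have le: "of_nat n * sqinc h x \<le> C\<^sup>2" for n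
    using sqinc_iterate[OF h C, of n x] eq by simp
  have nn: "0 \<le> sqinc h x" unfolding sqinc_def by simp
  show ?thesis
  proof (rule ccontr)
    assume "sqinc h x \<noteq> 0"
    then have "sqinc h x > 0" using nn by simp
    then obtain n where "C\<^sup>2 < of_nat n * sqinc h x" using reals_Archimedean3 by blast
    then show False using le[of n] by linarith
  qed
qed

end

section \<open>Increments of an antiderivative\<close>

lemma filterlim_shift_at_top: "filterlim (\<lambda>x. x + b) at_top (at_top :: real filter)"
  using filterlim_tendsto_add_at_top[OF tendsto_const[of b] filterlim_ident] by (simp add: add.commute)

text \<open>Rescaling the window to the unit interval gives one formula for both signs of
  \<open>a\<close>, over a domain that does not depend on \<open>a\<close>.\<close>

lemma antiderivative_increment_eq:
  fixes h H :: "real \<Rightarrow> real"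
  assumes H: "\<And>x. (H has_field_derivative h x) (at x)" and cont: "continuous_on UNIV h"
  shows "H t - H (t - a) = (\<integral>u. indicator {0..1} u * (a * h (t - a * u)) \<partial>lborel)"
proof -
  have "(\<integral>u. indicator {0..1} u *\<^sub>R (a * h (t - a * u)) \<partial>lborel) = (- H (t - a * 1)) - (- H (t - a * 0))"
  proof (rule integral_FTC_Icc)
    show "((\<lambda>u. - H (t - a * u)) has_vector_derivative a * h (t - a * u)) (at u within {0..1})" for u
      unfolding has_real_derivative_iff_has_vector_derivative[symmetric]
      by (rule DERIV_subset[of _ _ _ UNIV]) (auto intro!: derivative_eq_intros DERIV_chain2[OF H])
    show "continuous_on {0..1} (\<lambda>u. a * h (t - a * u))"
      by (intro continuous_intros continuous_on_compose2[OF cont]) auto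
  qed simp
  then show ?thesis by simp
qed

text \<open>Bounded convergence on the unit interval. The functions \<open>s\<close> and
  \<open>g\<close> let one proof serve both ends of the line: \<open>s t = t\<close> with
  \<open>g = h\<close> at plus infinity, and \<open>s t = - t\<close> with \<open>g = 0\<close> at
  minus infinity.\<close>

lemma antiderivative_increment_tendsto:
  fixes h H g :: "real \<Rightarrow> real"
  assumes H: "\<And>x. (H has_field_derivative h x) (at x)" and cont: "continuous_on UNIV h"
    and C: "\<And>x. \<bar>h x\<bar> \<le> C" and g: "\<And>t. \<bar>g t\<bar> \<le> C"
    and lim: "\<And>b. ((\<lambda>t. h (s t - b) - g t) \<longlongrightarrow> 0) at_top"
  shows "((\<lambda>t::real. H (s t) - H (s t - a) - a * g t) \<longlongrightarrow> 0) at_top"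
proof -
  have [measurable]: "h \<in> borel_measurable borel"
    using cont by (simp add: borel_measurable_continuous_onI)
  have int: "integrable lborel (\<lambda>u::real. indicator {0..1} u * c)" for c :: real
    by (intro integrable_mult_left) (auto simp: integrable_real_indicator)
  have eq: "H (s t) - H (s t - a) - a * g t = (\<integral>u. indicator {0..1} u * (a * (h (s t - a * u) - g t)) \<partial>lborel)" for t
  proof -
    have "integrable lborel (\<lambda>u. indicator {0..1} u * (a * h (s t - a * u)))"
      by (rule Bochner_Integration.integrable_bound[OF int[of "a * C"]])
        (use C in \<open>auto simp: indicator_def abs_mult intro!: AE_I2 mult_left_mono order_trans[OF C abs_ge_self]\<close>)
    then have "(\<integral>u. indicator {0..1} u * (a * h (s t - a * u)) - indicator {0..1} u * (a * g t) \<partial>lborel)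
      = H (s t) - H (s t - a) - a * g t"
      using int[of "a * g t"] by (simp add: antiderivative_increment_eq[OF H cont])
    then show ?thesis by (simp add: algebra_simps)
  qed
  have "((\<lambda>t. \<integral>u. indicator {0..1} u * (a * (h (s t - a * u) - g t)) \<partial>lborel) \<longlongrightarrow> (\<integral>u. 0 \<partial>(lborel :: real measure))) at_top"
  proof (rule integral_dominated_convergence_at_top[where w="\<lambda>u. indicator {0..1} u * (\<bar>a\<bar> * (2 * C))"])
    show "AE u in lborel. ((\<lambda>t. indicator {0..1} u * (a * (h (s t - a * u) - g t))) \<longlongrightarrow> 0) at_top"
      by (intro AE_I2 tendsto_mult_right_zero lim)
    show "\<forall>\<^sub>F t in at_top. AE u in lborel. norm (indicator {0..1} u * (a * (h (s t - a * u) - g t)))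
        \<le> indicator {0..1} u * (\<bar>a\<bar> * (2 * C))"
    proof (intro always_eventually allI AE_I2)
      fix t u
      have "\<bar>h (s t - a * u) - g t\<bar> \<le> 2 * C" using C[of "s t - a * u"] g[of t] by linarith
      then show "norm (indicator {0..1} u * (a * (h (s t - a * u) - g t))) \<le> indicator {0..1} u * (\<bar>a\<bar> * (2 * C))"
        by (auto simp: indicator_def abs_mult intro: mult_left_mono)
    qed
  qed (auto intro!: int)
  then show ?thesis by (simp add: eq)
qed

lemma exists_small_multiplier:
  fixes K e :: real assumes "0 \<le> K" "0 < e" obtains r where "r > 0" "K * r \<le> e"
proof (rule that)
  \<comment> \<open>The denominator is \<open>K + 1\<close> because \<open>K\<close> may be
    0.\<close>
  show "e / (K + 1) > 0" using assms by simp
  have "K * (e / (K + 1)) = e * (K / (K + 1))" by simp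
  also have "\<dots> \<le> e * 1" using assms by (intro mult_left_mono) (auto simp: divide_le_eq_1)
  finally show "K * (e / (K + 1)) \<le> e" by simp
qed

section \<open>From vanishing mean square increments to the renewal limit\<close>

context real_distribution
begin

text \<open>The shifts \<open>a\<close> for which the claim holds form a closed subgroup
  \<open>G\<close>: a group since \<open>F\<close> is invariant under translation, closed since
  \<open>h\<close> is Lipschitz. As \<open>sqinc h\<close> vanishes along \<open>F\<close>,
  \<open>G\<close> carries the step law, so the nonlattice hypothesis leaves only the whole line.
  Besides \<open>at_top\<close>, the filter \<open>top\<close> is of interest, where convergence
  means equality at every point.\<close>

lemma increment_tendsto_0:
  fixes F :: "real filter"
  assumes h: "bounded_borel h" and lip: "\<And>x y. \<bar>h x - h y\<bar> \<le> K * \<bar>x - y\<bar>"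
    and sq: "(sqinc h \<longlongrightarrow> 0) F"
    and nl: "\<And>d. d > 0 \<Longrightarrow> \<not> (AE x in M. x \<in> range (\<lambda>k::int. d * of_int k))"
    and F: "\<And>b. filterlim (\<lambda>x. x + b) F F"
  shows "((\<lambda>x. h (x - a) - h x) \<longlongrightarrow> 0) F"
proof -
  define G where "G = {a. ((\<lambda>x. h (x - a) - h x) \<longlongrightarrow> 0) F}"
  have K: "0 \<le> K" using lip[of 1 0] by auto
  have diffG: "a - b \<in> G" if "a \<in> G" "b \<in> G" for a b
  proof -
    \<comment> \<open>Both increments are started from \<open>x + b\<close>, so that their
      difference is the increment over \<open>a - b\<close> at \<open>x\<close>.\<close>
    have "((\<lambda>x. (h (x + b - a) - h (x + b)) - (h (x + b - b) - h (x + b))) \<longlongrightarrow> 0 - 0) F"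
      using that unfolding G_def mem_Collect_eq
      by (intro tendsto_diff) (erule filterlim_compose[OF _ F])+
    moreover have "(\<lambda>x. (h (x + b - a) - h (x + b)) - (h (x + b - b) - h (x + b))) = (\<lambda>x. h (x - (a - b)) - h x)"
      by (simp add: algebra_simps)
    ultimately show ?thesis by (simp add: G_def)
  qed
  have clG: "closed G"
  proof -
    have "a \<in> G" if a: "a \<in> closure G" for a
      unfolding G_def mem_Collect_eq
    proof (rule tendstoI)
      fix e :: real assume e: "e > 0"
      then obtain r where r: "r > 0" "K * r \<le> e / 2" using exists_small_multiplier[OF K, of "e / 2"] by auto
      then obtain b where b: "b \<in> G" "dist b a < r" using a unfolding closure_approachable by blast
      have Kb: "K * \<bar>b - a\<bar> \<le> e / 2"
        using mult_left_mono[of "\<bar>b - a\<bar>" r K] b(2) r K by (auto simp: dist_real_def)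
      have "eventually (\<lambda>x. dist (h (x - b) - h x) 0 < e / 2) F"
        using b(1) e unfolding G_def by (intro tendstoD) auto
      then show "eventually (\<lambda>x. dist (h (x - a) - h x) 0 < e) F"
      proof eventually_elim
        case (elim x)
        have "\<bar>h (x - a) - h (x - b)\<bar> \<le> e / 2" using lip[of "x - a" "x - b"] Kb by simp
        moreover have "\<bar>h (x - b) - h x\<bar> < e / 2" using elim by simp
        ultimately have "\<bar>h (x - a) - h x\<bar> < e" by linarith
        then show ?case by simp
      qed
    qed
    then have "closure G \<subseteq> G" by (rule subsetI)
    then show ?thesis unfolding closure_subset_eq .
  qed
  have zG: "0 \<in> G" by (simp add: G_def)
  have AE_G: "AE x in M. x \<in> G"
  proof -
    \<comment> \<open>Points of the topological support of \<open>M\<close> lie in \<open>G\<close>.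
      If the increment over \<open>a\<close> is at least \<open>e\<close>, the Lipschitz bound keeps
      it at least \<open>e / 2\<close> for all steps in a ball around \<open>a\<close>, which forces
      \<open>sqinc h x\<close> to be at least \<open>q\<close>.\<close>
    have supp: "a \<in> G" if pos: "\<And>r. r > 0 \<Longrightarrow> prob (ball a r) > 0" for a
      unfolding G_def mem_Collect_eq
    proof (rule tendstoI)
      fix e :: real assume e: "e > 0"
      then obtain r where r: "r > 0" and Kr: "K * r \<le> e / 2"
        using exists_small_multiplier[OF K, of "e / 2"] by auto
      define q where "q = prob (ball a r) * (e / 2)\<^sup>2"
      have "q > 0" using pos[OF r] e by (simp add: q_def)
      from order_tendstoD(2)[OF sq this] have "eventually (\<lambda>x. sqinc h x < q) F" .
      then show "eventually (\<lambda>x. dist (h (x - a) - h x) 0 < e) F"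
      proof eventually_elim
        case (elim x)
        show ?case
        proof (rule ccontr)
          assume "\<not> ?thesis"
          then have large: "\<bar>h (x - a) - h x\<bar> \<ge> e" by simp
          have "indicator (ball a r) b * (e / 2)\<^sup>2 \<le> (h (x - b) - h x)\<^sup>2" for b
          proof (cases "b \<in> ball a r")
            case True
            then have "\<bar>(x - b) - (x - a)\<bar> \<le> r" by (simp add: dist_real_def)
            then have "K * \<bar>(x - b) - (x - a)\<bar> \<le> K * r" using K by (rule mult_left_mono)
            then have "e / 2 \<le> \<bar>h (x - b) - h x\<bar>"
              using large lip[of "x - b" "x - a"] Kr by linarith
            then have "(e / 2)\<^sup>2 \<le> \<bar>h (x - b) - h x\<bar>\<^sup>2" using e by (intro power_mono) auto
            then show ?thesis using True by simp
          qed auto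
          moreover have "integrable M (\<lambda>b. (h (x - b) - h x)\<^sup>2)"
          proof -
            have "bounded_borel (\<lambda>y. (h y - h x) * (h y - h x))"
              using h by (intro bounded_borel_mult bounded_borel_diff bounded_borel_const)
            from integrable_shift[OF this, of x] show ?thesis by (simp add: power2_eq_square)
          qed
          moreover have "integrable M (indicator (ball a r) :: real \<Rightarrow> real)"
            by (intro integrable_real_indicator) (simp_all add: emeasure_eq_measure)
          ultimately have "(\<integral>b. indicator (ball a r) b * (e / 2)\<^sup>2 \<partial>M) \<le> sqinc h x"
            unfolding sqinc_def by (intro integral_mono integrable_mult_left) simp_all
          then show False using elim by (simp add: q_def)
        qed
      qed
    qed
    \<comment> \<open>The complement of the support is a union of null balls. By Lindelof countably
      many of them suffice, so it is null.\<close>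
    define B where "B = {ball a r | a r. prob (ball a r) = 0}"
    have op: "open S" if "S \<in> B" for S using that unfolding B_def by blast
    obtain B' where B': "B' \<subseteq> B" "countable B'" "\<Union>B' = \<Union>B"
      by (rule Lindelof[of B], erule op, rule that)
    have null: "S \<in> null_sets M" if "S \<in> B'" for S
    proof -
      obtain a r where "S = ball a r" "prob (ball a r) = 0" using \<open>S \<in> B'\<close> B'(1) unfolding B_def by blast
      then show ?thesis by (simp add: emeasure_eq_measure null_setsI)
    qed
    have "(\<Union>S\<in>B'. S) \<in> null_sets M" by (rule null_sets_UN'[OF B'(2)]) (rule null)
    then have "\<Union>B \<in> null_sets M" using B'(3) by simp
    then show ?thesis
    proof (rule AE_I')
      show "{x \<in> space M. x \<notin> G} \<subseteq> \<Union>B"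
      proof
        fix x assume "x \<in> {x \<in> space M. x \<notin> G}"
        then obtain r where r: "r > 0" "\<not> prob (ball x r) > 0" using supp[of x] by blast
        then have "prob (ball x r) = 0" by (simp add: zero_less_measure_iff)
        then have "ball x r \<in> B" unfolding B_def by blast
        then show "x \<in> \<Union>B" by (rule UnionI) (simp add: r)
      qed
    qed
  qed
  have "G = UNIV \<or> (\<exists>d>0. G \<subseteq> range (\<lambda>k::int. d * of_int k))"
    by (rule closed_real_subgroup_cases) (fact clG zG diffG)+
  then have "G = UNIV"
  proof
    assume "\<exists>d>0. G \<subseteq> range (\<lambda>k::int. d * of_int k)"
    then obtain d where d: "d > 0" "G \<subseteq> range (\<lambda>k::int. d * of_int k)" by blast
    have "AE x in M. x \<in> range (\<lambda>k::int. d * of_int k)"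
      using AE_G
    proof eventually_elim
      case (elim x)
      then show ?case by (rule subsetD[OF d(2)])
    qed
    with nl[OF d(1)] show ?thesis by (rule notE)
  qed
  then have "a \<in> G" by simp
  then show ?thesis by (simp add: G_def)
qed

text \<open>With \<open>H' = h\<close>, the function \<open>J t = \<integral>a. H t - H (t - a) \<partial>M\<close> has derivative \<open>h - avg h \<ge> 0\<close>,
  so it converges; since \<open>h\<close> is asymptotically constant on bounded windows, \<open>J t\<close> is asymptotic
  to \<open>h t\<close> times the mean of the step.\<close>

theorem renewal_limit:
  assumes lip: "\<And>x y. \<bar>h x - h y\<bar> \<le> K * \<bar>x - y\<bar>"
    and C: "\<And>x. \<bar>h x\<bar> \<le> C"
    and bot: "(h \<longlongrightarrow> 0) at_bot"
    and z0: "\<And>x. avg h x \<le> h x" and zlim: "((\<lambda>x. h x - avg h x) \<longlongrightarrow> 0) at_top"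
    and ne: "h x0 \<noteq> 0"
    and nl: "\<And>d. d > 0 \<Longrightarrow> \<not> (AE x in M. x \<in> range (\<lambda>k::int. d * of_int k))"
    and int: "integrable M (\<lambda>x. x)" and mu: "expectation (\<lambda>x. x) > 0"
  shows "\<exists>L>0. (h \<longlongrightarrow> L) at_top"
proof -
  define \<mu> where "\<mu> = expectation (\<lambda>x. x)"
  have mupos: "\<mu> > 0" using mu by (simp add: \<mu>_def)
  have K: "0 \<le> K" using lip[of 1 0] by auto
  have C0: "0 \<le> C" using C[of 0] by linarith
  have cont: "continuous_on UNIV h"
  proof (rule continuous_onI)
    fix x e :: real assume "e > 0"
    obtain r where r: "r > 0" "K * r \<le> e" using exists_small_multiplier[OF K \<open>e > 0\<close>] by auto
    have "dist (h x') (h x) \<le> e" if "dist x' x < r" for x'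
      using mult_left_mono[of "\<bar>x' - x\<bar>" r K] lip[of x' x] that r K by (auto simp: dist_real_def)
    then show "\<exists>d>0. \<forall>x'\<in>UNIV. dist x' x < d \<longrightarrow> dist (h x') (h x) \<le> e" using r by blast
  qed
  have [measurable]: "h \<in> borel_measurable borel" using cont by (rule borel_measurable_continuous_onI)
  have h: "bounded_borel h" by (rule bounded_borelI[OF _ C]) measurable
  have incr: "((\<lambda>x. h (x - a) - h x) \<longlongrightarrow> 0) at_top" for a
    by (rule increment_tendsto_0[OF h lip sqinc_tendsto_0[OF h zlim] nl filterlim_shift_at_top])
  \<comment> \<open>An antiderivative on the whole line; the constant is immaterial because only
    increments of \<open>H\<close> occur.\<close>
  obtain H where H: "\<And>x. (H has_field_derivative h x) (at x)"
    using einterval_antiderivative[of "-\<infinity>" "\<infinity>" h] cont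
    by (auto simp: has_real_derivative_iff_has_vector_derivative continuous_on_eq_continuous_at)
  have contH: "continuous_on UNIV H" using H DERIV_isCont continuous_at_imp_continuous_on by blast
  then have [measurable]: "H \<in> borel_measurable borel" by (rule borel_measurable_continuous_onI)
  have mvt: "\<exists>c. H s - H t = (s - t) * h c \<and> \<bar>c - t\<bar> \<le> \<bar>s - t\<bar>" for s t
  proof (cases s t rule: linorder_cases)
    case less
    then obtain c where "s < c" "c < t" "H t - H s = (t - s) * h c" using MVT2[of s t H h] H by blast
    then show ?thesis by (intro exI[of _ c]) (auto simp: algebra_simps)
  next
    case greater
    then obtain c where "t < c" "c < s" "H s - H t = (s - t) * h c" using MVT2[of t s H h] H by blast
    then show ?thesis by (intro exI[of _ c]) auto
  qed auto
  have HC: "\<bar>H s - H t\<bar> \<le> C * \<bar>s - t\<bar>" for s t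
  proof -
    obtain c where "H s - H t = (s - t) * h c" using mvt by blast
    then have "\<bar>H s - H t\<bar> = \<bar>s - t\<bar> * \<bar>h c\<bar>" by (simp add: abs_mult)
    also have "\<dots> \<le> \<bar>s - t\<bar> * C" by (intro mult_left_mono C) simp
    finally show ?thesis by (simp add: mult.commute)
  qed
  \<comment> \<open>A first-order Taylor bound that is uniform in \<open>t\<close>, thanks to the
    Lipschitz constant of \<open>h\<close>.\<close>
  have HK: "\<bar>H s - H t - (s - t) * h t\<bar> \<le> K * \<bar>s - t\<bar> * \<bar>s - t\<bar>" for s t
  proof -
    obtain c where c: "H s - H t = (s - t) * h c" "\<bar>c - t\<bar> \<le> \<bar>s - t\<bar>" using mvt by blast
    have "\<bar>H s - H t - (s - t) * h t\<bar> = \<bar>s - t\<bar> * \<bar>h c - h t\<bar>" using c(1) by (simp add: abs_mult[symmetric] algebra_simps)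
    also have "\<dots> \<le> \<bar>s - t\<bar> * (K * \<bar>s - t\<bar>)"
      using lip[of c t] c(2) K by (intro mult_left_mono) (auto intro: order_trans mult_left_mono)
    finally show ?thesis by (simp add: algebra_simps)
  qed
  define J where "J t = (\<integral>a. H t - H (t - a) \<partial>M)" for t
  have intx: "integrable M (\<lambda>x. \<bar>x\<bar>)" using int by simp
  have HC0: "\<bar>H t - H (t - a)\<bar> \<le> C * \<bar>a\<bar>" for t a using HC[of t "t - a"] by simp
  define D where "D t a = H t - H (t - a)" for t a
  have J: "J t = (\<integral>a. D t a \<partial>M)" for t by (simp add: J_def D_def)
  have iD: "integrable M (D t)" for t
    unfolding D_def[abs_def]
    by (rule Bochner_Integration.integrable_bound[of M "\<lambda>x. C * \<bar>x\<bar>"])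
      (use HC0[of t] C0 intx in \<open>auto simp: abs_mult\<close>)
  have JC: "\<bar>J t\<bar> \<le> C * (\<integral>x. \<bar>x\<bar> \<partial>M)" for t
  proof -
    have "\<bar>J t\<bar> \<le> (\<integral>a. \<bar>D t a\<bar> \<partial>M)" unfolding J by (rule integral_abs_bound)
    also have "\<dots> \<le> (\<integral>a. C * \<bar>a\<bar> \<partial>M)"
      by (intro integral_mono integrable_abs iD integrable_mult_right intx) (use HC0 in \<open>simp add: D_def\<close>)
    finally show ?thesis by simp
  qed
  \<comment> \<open>Integrating the uniform bound \<open>HK\<close>, at \<open>t\<close> and at
    \<open>t - a\<close>, takes the place of differentiation under the integral sign.\<close>
  have J_quad: "\<bar>J s - J t - (s - t) * (h t - avg h t)\<bar> \<le> 2 * K * \<bar>s - t\<bar> * \<bar>s - t\<bar>" for s t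
  proof -
    define E where "E a = h t - h (t - a)" for a
    define Q where "Q a = D s a - D t a - (s - t) * E a" for a
    have ih: "integrable M (\<lambda>a. h (t - a))" by (rule integrable_shift[OF h])
    have iE: "integrable M E" unfolding E_def[abs_def] using ih by simp
    have intE: "(\<integral>a. E a \<partial>M) = h t - avg h t" unfolding E_def avg_def using ih prob_space by simp
    have iQ: "integrable M Q" unfolding Q_def[abs_def]
      by (intro Bochner_Integration.integrable_diff integrable_mult_right iD iE)
    have "J s - J t - (s - t) * (h t - avg h t) = (\<integral>a. Q a \<partial>M)"
      unfolding Q_def J intE[symmetric] using iD[of s] iD[of t] iE by simp
    then have "\<bar>J s - J t - (s - t) * (h t - avg h t)\<bar> \<le> (\<integral>a. \<bar>Q a\<bar> \<partial>M)"
      using integral_abs_bound[of M Q] by simp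
    also have "\<dots> \<le> (\<integral>a. 2 * K * \<bar>s - t\<bar> * \<bar>s - t\<bar> \<partial>M)"
    proof (intro integral_mono integrable_abs iQ integrable_const)
      fix a
      have "Q a = (H s - H t - (s - t) * h t) - (H (s - a) - H (t - a) - (s - t) * h (t - a))"
        by (simp add: Q_def D_def E_def algebra_simps)
      moreover have "\<bar>H (s - a) - H (t - a) - (s - t) * h (t - a)\<bar> \<le> K * \<bar>s - t\<bar> * \<bar>s - t\<bar>"
        using HK[of "s - a" "t - a"] by simp
      ultimately show "\<bar>Q a\<bar> \<le> 2 * K * \<bar>s - t\<bar> * \<bar>s - t\<bar>" using HK[of s t] by linarith
    qed
    finally show ?thesis using prob_space by simp
  qed
  have J_deriv: "(J has_field_derivative h t - avg h t) (at t)" for t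
    unfolding DERIV_def
  proof (rule LIM_zero_cancel, rule Lim_null_comparison)
    show "((\<lambda>s. 2 * K * \<bar>s\<bar>) \<longlongrightarrow> 0) (at 0)" by (auto intro!: tendsto_eq_intros)
    show "\<forall>\<^sub>F s in at 0. norm ((J (t + s) - J t) / s - (h t - avg h t)) \<le> 2 * K * \<bar>s\<bar>"
      unfolding eventually_at_filter
    proof (intro always_eventually allI impI)
      fix s :: real assume s: "s \<noteq> 0"
      have "(J (t + s) - J t) / s - (h t - avg h t) = (J (t + s) - J t - s * (h t - avg h t)) / s"
        using s by (simp add: field_simps)
      then show "norm ((J (t + s) - J t) / s - (h t - avg h t)) \<le> 2 * K * \<bar>s\<bar>"
        using J_quad[of "t + s" t] s by (simp add: abs_divide pos_divide_le_eq)
    qed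
  qed
  have J_mono: "J s \<le> J t" if "s \<le> t" for s t
    by (rule DERIV_nonneg_imp_nondecreasing[OF that]) (use J_deriv z0 in \<open>auto intro!: exI\<close>)
  \<comment> \<open>Integration of \<open>antiderivative_increment_tendsto\<close> over the step,
    with the dominating function \<open>2 * C * \<bar>a\<bar>\<close>. This is where the finite mean
    of the step enters.\<close>
  have J_lim: "((\<lambda>t. J (s t) - \<mu> * g t) \<longlongrightarrow> 0) at_top"
    if g: "\<And>t. \<bar>g t\<bar> \<le> C" and lim: "\<And>b. ((\<lambda>t. h (s t - b) - g t) \<longlongrightarrow> 0) at_top" for s g :: "real \<Rightarrow> real"
  proof -
    have "((\<lambda>t. \<integral>a. H (s t) - H (s t - a) - a * g t \<partial>M) \<longlongrightarrow> (\<integral>a. 0 \<partial>M)) at_top"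
    proof (rule integral_dominated_convergence_at_top[where w="\<lambda>a. 2 * C * \<bar>a\<bar>"])
      show "AE a in M. ((\<lambda>t. H (s t) - H (s t - a) - a * g t) \<longlongrightarrow> 0) at_top"
        by (intro AE_I2 antiderivative_increment_tendsto[OF H cont C g lim])
      show "\<forall>\<^sub>F t in at_top. AE a in M. norm (H (s t) - H (s t - a) - a * g t) \<le> 2 * C * \<bar>a\<bar>"
      proof (intro always_eventually allI AE_I2)
        fix t a
        have "\<bar>a * g t\<bar> \<le> C * \<bar>a\<bar>" using mult_left_mono[OF g[of t], of "\<bar>a\<bar>"] by (simp add: abs_mult mult.commute)
        then show "norm (H (s t) - H (s t - a) - a * g t) \<le> 2 * C * \<bar>a\<bar>"
          using HC[of "s t" "s t - a"] by simp
      qed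
    qed (use intx in auto)
    moreover have "(\<integral>a. D (s t) a - a * g t \<partial>M) = J (s t) - \<mu> * g t" for t
      using iD int by (simp add: J \<mu>_def)
    ultimately show ?thesis by (simp add: D_def)
  qed
  define l where "l = (SUP t. J t)"
  have bdd: "bdd_above (range J)" using JC by (intro bdd_aboveI[of _ "C * (\<integral>x. \<bar>x\<bar> \<partial>M)"]) (auto simp: abs_le_iff)
  have Jl: "(J \<longlongrightarrow> l) at_top"
  proof (rule increasing_tendsto)
    show "\<forall>\<^sub>F t in at_top. J t \<le> l" unfolding l_def by (intro always_eventually allI cSUP_upper bdd) auto
    fix y assume "y < l"
    then obtain t0 where t0: "y < J t0" unfolding l_def using less_cSUP_iff[OF _ bdd] by auto
    show "\<forall>\<^sub>F t in at_top. y < J t"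
      using eventually_ge_at_top[of t0]
    proof eventually_elim
      case (elim t)
      then show ?case using J_mono[of t0 t] t0 by linarith
    qed
  qed
  \<comment> \<open>\<open>J\<close> converges and \<open>J - \<mu> * h\<close> tends to 0, so
    \<open>h\<close> converges because \<open>\<mu>\<close> is positive.\<close>
  have "((\<lambda>t. (J t - (J t - \<mu> * h t)) / \<mu>) \<longlongrightarrow> (l - 0) / \<mu>) at_top"
    using mupos by (intro tendsto_divide tendsto_diff Jl J_lim[of h "\<lambda>t. t"] C incr tendsto_const) auto
  then have hl: "(h \<longlongrightarrow> l / \<mu>) at_top" using mupos by simp
  \<comment> \<open>Here \<open>s t = - t\<close> and \<open>g = 0\<close> in \<open>J_lim\<close>.
    With monotonicity this gives \<open>J \<ge> 0\<close>.\<close>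
  have J_bot: "((\<lambda>t. J (- t)) \<longlongrightarrow> 0) at_top"
  proof -
    have "((\<lambda>t. h (- t - b) - 0) \<longlongrightarrow> 0) at_top" for b
    proof -
      have "filterlim (\<lambda>t::real. - t - b) at_bot at_top"
        using filterlim_compose[OF filterlim_uminus_at_bot_at_top filterlim_shift_at_top[of b]] by simp
      from filterlim_compose[OF bot this] show ?thesis by simp
    qed
    from J_lim[OF _ this] show ?thesis using C0 by simp
  qed
  have J0: "0 \<le> J t" for t
  proof (rule tendsto_upperbound[OF J_bot])
    show "\<forall>\<^sub>F s in at_top. J (- s) \<le> J t"
      using eventually_ge_at_top[of "- t"] by eventually_elim (auto intro: J_mono)
  qed simp
  have lJ: "J t \<le> l" for t unfolding l_def by (intro cSUP_upper bdd) auto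
  have "l \<noteq> 0"
  proof
    assume "l = 0"
    \<comment> \<open>\<open>J\<close> lies between 0 and its supremum \<open>l\<close>, so
      \<open>l = 0\<close> makes it constant and its derivative \<open>h - avg h\<close>
      zero.\<close>
    then have "J = (\<lambda>t. 0)" using J0 lJ by (auto simp: fun_eq_iff intro: antisym)
    then have "h t - avg h t = 0" for t using DERIV_unique[OF J_deriv[of t], of 0] by simp
    then have "avg h = h" by (simp add: fun_eq_iff)
    then have "sqinc h = (\<lambda>_. 0)" using sqinc_harmonic[OF h] by blast
    \<comment> \<open>\<open>sqinc h\<close> is identically 0, so \<open>increment_tendsto_0\<close>
      applies along \<open>top\<close> and yields that \<open>h\<close> is constant, not merely
      asymptotically so.\<close>
    then have sq0: "(sqinc h \<longlongrightarrow> 0) top" by simp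
    have "((\<lambda>x. h (x - a) - h x) \<longlongrightarrow> 0) top" for a
      by (rule increment_tendsto_0[OF h lip sq0 nl]) (auto simp: filterlim_top)
    then have ev: "eventually (\<lambda>x. dist (h (x - a) - h x) 0 < e) top" if "e > 0" for a e
      using that by (rule tendstoD)
    have "h (x - a) = h x" for x a
    proof (rule ccontr)
      assume "h (x - a) \<noteq> h x"
      then have "\<bar>h (x - a) - h x\<bar> > 0" by simp
      from ev[OF this, of a] show False unfolding eventually_top by (auto dest: spec[of _ x])
    qed
    from this[of x0 "x0 - y" for y] have "h y = h x0" for y by simp
    then obtain c where hc: "h = (\<lambda>_. c)" by blast
    have "c = 0" using bot unfolding hc by (simp add: tendsto_const_iff)
    then show False using ne by (simp add: hc)
  qed
  moreover have "0 \<le> l" using J0[of 0] lJ[of 0] by linarith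
  ultimately have "l / \<mu> > 0" using mupos by simp
  then show ?thesis using hl by blast
qed

end

section \<open>Splitting off the first step\<close>

text \<open>Tonelli on both sides. It regroups (first step, later steps) and perturbations into
  first step and (later steps, perturbations).\<close>

lemma distr_pair_measure_assoc:
  assumes "sigma_finite_measure A" "sigma_finite_measure B" "sigma_finite_measure C"
  shows "distr ((A \<Otimes>\<^sub>M B) \<Otimes>\<^sub>M C) (A \<Otimes>\<^sub>M (B \<Otimes>\<^sub>M C)) (\<lambda>p. (fst (fst p), (snd (fst p), snd p))) = A \<Otimes>\<^sub>M (B \<Otimes>\<^sub>M C)"
proof (rule measure_eqI)
  interpret A: sigma_finite_measure A by fact
  interpret B: sigma_finite_measure B by fact
  interpret C: sigma_finite_measure C by fact
  interpret BC: pair_sigma_finite B C ..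
  fix E assume "E \<in> sets (distr ((A \<Otimes>\<^sub>M B) \<Otimes>\<^sub>M C) (A \<Otimes>\<^sub>M (B \<Otimes>\<^sub>M C)) (\<lambda>p. (fst (fst p), (snd (fst p), snd p))))"
  then have E[measurable]: "E \<in> sets (A \<Otimes>\<^sub>M (B \<Otimes>\<^sub>M C))" by simp
  let ?g = "\<lambda>p. (fst (fst p), (snd (fst p), snd p))"
  have "emeasure (distr ((A \<Otimes>\<^sub>M B) \<Otimes>\<^sub>M C) (A \<Otimes>\<^sub>M (B \<Otimes>\<^sub>M C)) ?g) E
     = (\<integral>\<^sup>+p. indicator E p \<partial>distr ((A \<Otimes>\<^sub>M B) \<Otimes>\<^sub>M C) (A \<Otimes>\<^sub>M (B \<Otimes>\<^sub>M C)) ?g)"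
    by simp
  also have "\<dots> = (\<integral>\<^sup>+p. indicator E (?g p) \<partial>((A \<Otimes>\<^sub>M B) \<Otimes>\<^sub>M C))"
    by (rule nn_integral_distr) measurable
  also have "\<dots> = (\<integral>\<^sup>+p. \<integral>\<^sup>+c. indicator E (fst p, (snd p, c)) \<partial>C \<partial>(A \<Otimes>\<^sub>M B))"
    by (subst C.nn_integral_fst[symmetric]) simp_all
  also have "\<dots> = (\<integral>\<^sup>+a. \<integral>\<^sup>+b. \<integral>\<^sup>+c. indicator E (a, (b, c)) \<partial>C \<partial>B \<partial>A)"
    by (subst B.nn_integral_fst[symmetric]) simp_all
  also have "\<dots> = (\<integral>\<^sup>+a. \<integral>\<^sup>+q. indicator E (a, q) \<partial>(B \<Otimes>\<^sub>M C) \<partial>A)"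
  proof (rule nn_integral_cong)
    fix a assume [measurable]: "a \<in> space A"
    show "(\<integral>\<^sup>+b. \<integral>\<^sup>+c. indicator E (a, (b, c)) \<partial>C \<partial>B) = (\<integral>\<^sup>+q. indicator E (a, q) \<partial>(B \<Otimes>\<^sub>M C))"
      by (rule C.nn_integral_fst) measurable
  qed
  also have "\<dots> = (\<integral>\<^sup>+p. indicator E p \<partial>(A \<Otimes>\<^sub>M (B \<Otimes>\<^sub>M C)))"
    by (rule BC.nn_integral_fst) simp
  finally show "emeasure (distr ((A \<Otimes>\<^sub>M B) \<Otimes>\<^sub>M C) (A \<Otimes>\<^sub>M (B \<Otimes>\<^sub>M C)) ?g) E = emeasure (A \<Otimes>\<^sub>M (B \<Otimes>\<^sub>M C)) E"
    by simp
qed simp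

lemma measurable_seq_shift: "(\<lambda>f j. f (Suc j)) \<in> PiM {1..} (\<lambda>_. N) \<rightarrow>\<^sub>M PiM UNIV (\<lambda>_::nat. N)"
  by (rule measurable_PiM_single') (auto simp: space_PiM PiE_iff)

lemma measurable_seq_shift_UNIV: "(\<lambda>f j. f (Suc j)) \<in> PiM UNIV (\<lambda>_. N) \<rightarrow>\<^sub>M PiM UNIV (\<lambda>_::nat. N)"
  by (rule measurable_PiM_single') (auto simp: space_PiM PiE_iff)

section \<open>Laws of a sequence and of its shift\<close>

context prob_space
begin

lemma indep_vars_reindex:
  assumes ind: "indep_vars (\<lambda>_. N) X (f ` I)" and inj: "inj_on f I"
  shows "indep_vars (\<lambda>_. N) (\<lambda>i. X (f i)) I"
  unfolding indep_vars_def2 indep_sets_def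
proof (intro conjI ballI allI impI)
  let ?E = "\<lambda>k. {X k -` A \<inter> space M |A. A \<in> sets N}"
  have E: "\<forall>k\<in>f ` I. ?E k \<subseteq> events"
    "\<And>J A. J \<subseteq> f ` I \<Longrightarrow> J \<noteq> {} \<Longrightarrow> finite J \<Longrightarrow> A \<in> Pi J ?E \<Longrightarrow> prob (\<Inter>j\<in>J. A j) = (\<Prod>j\<in>J. prob (A j))"
    using ind unfolding indep_vars_def2 indep_sets_def by blast+
  show "random_variable N (X (f i))" if "i \<in> I" for i using ind that unfolding indep_vars_def2 by blast
  show "?E (f i) \<subseteq> events" if "i \<in> I" for i using E(1) that by blast
  fix J A assume J: "J \<subseteq> I" "J \<noteq> {}" "finite J" and A: "A \<in> Pi J (\<lambda>i. ?E (f i))"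
  have injJ: "inj_on f J" using inj J(1) by (rule inj_on_subset)
  define B where "B k = A (the_inv_into J f k)" for k
  have B: "B (f j) = A j" if "j \<in> J" for j using the_inv_into_f_f[OF injJ that] by (simp add: B_def)
  have "B \<in> Pi (f ` J) ?E"
  proof (rule Pi_I)
    fix k assume "k \<in> f ` J"
    then obtain j where "j \<in> J" "k = f j" by blast
    then show "B k \<in> ?E k" using Pi_mem[OF A \<open>j \<in> J\<close>] B[OF \<open>j \<in> J\<close>] by simp
  qed
  then have "prob (\<Inter>k\<in>f ` J. B k) = (\<Prod>k\<in>f ` J. prob (B k))" using J by (intro E(2)) auto
  also have "\<dots> = (\<Prod>j\<in>J. prob (A j))" by (simp add: prod.reindex[OF injJ] B)
  also have "(\<Inter>k\<in>f ` J. B k) = (\<Inter>j\<in>J. A j)" using B by simp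
  finally show "prob (\<Inter>j\<in>J. A j) = (\<Prod>j\<in>J. prob (A j))" .
qed

text \<open>Unlike for \<open>indep_var\<close> itself, \<open>f\<close> and \<open>g\<close> may have values in different types.\<close>

lemma indep_var_distr_pair:
  assumes ind: "indep_var S A T B" and f[measurable]: "f \<in> S \<rightarrow>\<^sub>M S'" and g[measurable]: "g \<in> T \<rightarrow>\<^sub>M T'"
  shows "distr M (S' \<Otimes>\<^sub>M T') (\<lambda>\<omega>. (f (A \<omega>), g (B \<omega>)))
       = distr M S' (\<lambda>\<omega>. f (A \<omega>)) \<Otimes>\<^sub>M distr M T' (\<lambda>\<omega>. g (B \<omega>))"
proof -
  have [measurable]: "A \<in> M \<rightarrow>\<^sub>M S" "B \<in> M \<rightarrow>\<^sub>M T"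
    and eq: "distr M S A \<Otimes>\<^sub>M distr M T B = distr M (S \<Otimes>\<^sub>M T) (\<lambda>\<omega>. (A \<omega>, B \<omega>))"
    using ind unfolding indep_var_distribution_eq by blast+
  interpret B: prob_space "distr M T B" by (rule prob_space_distr) measurable
  have "distr M S' (\<lambda>\<omega>. f (A \<omega>)) \<Otimes>\<^sub>M distr M T' (\<lambda>\<omega>. g (B \<omega>))
      = distr (distr M S A) S' f \<Otimes>\<^sub>M distr (distr M T B) T' g"
    by (simp add: distr_distr comp_def)
  also have "\<dots> = distr (distr M S A \<Otimes>\<^sub>M distr M T B) (S' \<Otimes>\<^sub>M T') (\<lambda>(x, y). (f x, g y))"
    by (intro pair_measure_distr prob_space_imp_sigma_finite B.prob_space_distr) simp_all
  also have "\<dots> = distr M (S' \<Otimes>\<^sub>M T') (\<lambda>\<omega>. (f (A \<omega>), g (B \<omega>)))"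
    unfolding eq by (simp add: distr_distr comp_def)
  finally show ?thesis by simp
qed

text \<open>Disjoint blocks of indices are independent, and the shifted sequence has the same
  product law as the original one.\<close>

lemma distr_iid_split:
  fixes Y :: "nat \<Rightarrow> 'a \<Rightarrow> 'b"
  assumes ind: "indep_vars (\<lambda>_. N) Y UNIV" and id: "\<And>j. distr M N (Y j) = distr M N (Y 0)"
  shows "distr M (N \<Otimes>\<^sub>M PiM UNIV (\<lambda>_. N)) (\<lambda>\<omega>. (Y 0 \<omega>, \<lambda>j. Y (Suc j) \<omega>))
       = distr M N (Y 0) \<Otimes>\<^sub>M distr M (PiM UNIV (\<lambda>_. N)) (\<lambda>\<omega> j. Y j \<omega>)"
proof -
  have rv[measurable]: "Y j \<in> M \<rightarrow>\<^sub>M N" for j using ind unfolding indep_vars_def by simp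
  have "indep_var (PiM {0} (\<lambda>_. N)) (\<lambda>\<omega>. restrict (\<lambda>i. Y i \<omega>) {0}) (PiM {1..} (\<lambda>_. N)) (\<lambda>\<omega>. restrict (\<lambda>i. Y i \<omega>) {1..})"
    by (rule indep_var_restrict[OF ind]) auto
  from indep_var_distr_pair[OF this, of "\<lambda>f. f 0" N "\<lambda>f j. f (Suc j)" "PiM UNIV (\<lambda>_. N)"]
  have 1: "distr M (N \<Otimes>\<^sub>M PiM UNIV (\<lambda>_. N)) (\<lambda>\<omega>. (Y 0 \<omega>, \<lambda>j. Y (Suc j) \<omega>))
      = distr M N (Y 0) \<Otimes>\<^sub>M distr M (PiM UNIV (\<lambda>_. N)) (\<lambda>\<omega> j. Y (Suc j) \<omega>)"
    using measurable_seq_shift[of N] by simp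
  \<comment> \<open>Stated for any injective \<open>f\<close> so that it covers both the shift
    \<open>Suc\<close> and the identity.\<close>
  have law: "distr M (PiM UNIV (\<lambda>_. N)) (\<lambda>\<omega> j. Y (f j) \<omega>) = PiM UNIV (\<lambda>_. distr M N (Y 0))" if f: "inj f" for f
  proof -
    have "indep_vars (\<lambda>_. N) (\<lambda>j. Y (f j)) UNIV"
      by (rule indep_vars_reindex[OF indep_vars_subset[OF ind]]) (use f in auto)
    then have "distr M (PiM UNIV (\<lambda>_. N)) (\<lambda>\<omega> j. Y (f j) \<omega>) = (\<Pi>\<^sub>M j\<in>UNIV. distr M N (Y (f j)))"
      using indep_vars_iff_distr_eq_PiM[where I = UNIV and M' = "\<lambda>_. N" and X = "\<lambda>j. Y (f j)"]
      by (simp add: restrict_UNIV)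
    also have "\<dots> = PiM UNIV (\<lambda>_. distr M N (Y 0))" by (intro PiM_cong refl id)
    finally show ?thesis .
  qed
  show ?thesis unfolding 1 using law[of Suc] law[of "\<lambda>j. j"] by simp
qed

text \<open>The two dependence structures are reduced to one property: after the first step the
  process starts afresh, independently of \<open>X 1\<close>. The rest of the argument relies on
  this property and treats both cases alike.\<close>

lemma distr_pairs_split:
  fixes X \<xi> :: "nat \<Rightarrow> 'a \<Rightarrow> real"
  defines "S \<equiv> PiM UNIV (\<lambda>_::nat. borel :: real measure)"
  assumes "iid_pairs_case X \<xi> \<or> indep_stationary_case X \<xi>"
  shows "distr M (borel \<Otimes>\<^sub>M (S \<Otimes>\<^sub>M S)) (\<lambda>\<omega>. (X 1 \<omega>, (\<lambda>j. X (Suc (Suc j)) \<omega>, \<lambda>j. \<xi> (Suc j) \<omega>)))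
       = distr M borel (X 1) \<Otimes>\<^sub>M distr M (S \<Otimes>\<^sub>M S) (\<lambda>\<omega>. (\<lambda>j. X (Suc j) \<omega>, \<lambda>j. \<xi> j \<omega>))"
    and "\<And>j. X (Suc j) \<in> borel_measurable M" and "\<And>j. \<xi> j \<in> borel_measurable M"
proof -
  have "(distr M (borel \<Otimes>\<^sub>M (S \<Otimes>\<^sub>M S)) (\<lambda>\<omega>. (X 1 \<omega>, (\<lambda>j. X (Suc (Suc j)) \<omega>, \<lambda>j. \<xi> (Suc j) \<omega>)))
       = distr M borel (X 1) \<Otimes>\<^sub>M distr M (S \<Otimes>\<^sub>M S) (\<lambda>\<omega>. (\<lambda>j. X (Suc j) \<omega>, \<lambda>j. \<xi> j \<omega>)))
    \<and> (\<forall>j. X (Suc j) \<in> borel_measurable M) \<and> (\<forall>j. \<xi> j \<in> borel_measurable M)"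
    using assms(2)
  proof
    \<comment> \<open>The first pair is independent of the later pairs, and is then projected to
      \<open>X 1\<close>. Dependence between \<open>X 1\<close> and \<open>\<xi> 0\<close> does no
      harm, since \<open>\<xi> 0\<close> does not occur after the first step.\<close>
    assume "iid_pairs_case X \<xi>"
    then have ind: "indep_vars (\<lambda>_. borel :: (real \<times> real) measure) (\<lambda>j \<omega>. (X (Suc j) \<omega>, \<xi> j \<omega>)) UNIV"
      and id: "\<And>j. distr M borel (\<lambda>\<omega>. (X (Suc j) \<omega>, \<xi> j \<omega>)) = distr M borel (\<lambda>\<omega>. (X (Suc 0) \<omega>, \<xi> 0 \<omega>))"
      unfolding iid_pairs_case_def iid_vars_def by blast+
    let ?N = "borel :: (real \<times> real) measure"
    have rv: "(\<lambda>\<omega>. (X (Suc j) \<omega>, \<xi> j \<omega>)) \<in> M \<rightarrow>\<^sub>M ?N" for j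
      using ind unfolding indep_vars_def by simp
    have [measurable]: "X (Suc j) \<in> borel_measurable M" "\<xi> j \<in> borel_measurable M" for j
      using measurable_compose[OF rv borel_measurable_continuous_onI[OF continuous_on_fst[OF continuous_on_id]], of j]
        measurable_compose[OF rv borel_measurable_continuous_onI[OF continuous_on_snd[OF continuous_on_id]], of j] by simp_all
    have m: "(fst :: real \<times> real \<Rightarrow> real) \<in> borel_measurable ?N" "(snd :: real \<times> real \<Rightarrow> real) \<in> borel_measurable ?N"
      by (auto intro!: borel_measurable_continuous_onI continuous_intros)
    have g[measurable]: "(\<lambda>y. (\<lambda>j. fst (y j), \<lambda>j. snd (y j))) \<in> PiM UNIV (\<lambda>_. ?N) \<rightarrow>\<^sub>M S \<Otimes>\<^sub>M S"
      unfolding S_def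
      by (intro measurable_Pair measurable_PiM_single' measurable_compose[OF _ m(1)] measurable_compose[OF _ m(2)]) auto
    have A[measurable]: "(\<lambda>\<omega> j. (X (Suc j) \<omega>, \<xi> j \<omega>)) \<in> M \<rightarrow>\<^sub>M PiM UNIV (\<lambda>_. ?N)"
      "(\<lambda>\<omega> j. (X (Suc (Suc j)) \<omega>, \<xi> (Suc j) \<omega>)) \<in> M \<rightarrow>\<^sub>M PiM UNIV (\<lambda>_. ?N)"
      by (rule measurable_PiM_single'; auto intro: rv)+
    let ?Q = "distr M (PiM UNIV (\<lambda>_. ?N)) (\<lambda>\<omega> j. (X (Suc j) \<omega>, \<xi> j \<omega>))"
    interpret Q: prob_space ?Q by (rule prob_space_distr) measurable
    have "distr M borel (X 1) \<Otimes>\<^sub>M distr M (S \<Otimes>\<^sub>M S) (\<lambda>\<omega>. (\<lambda>j. X (Suc j) \<omega>, \<lambda>j. \<xi> j \<omega>))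
      = distr (distr M ?N (\<lambda>\<omega>. (X 1 \<omega>, \<xi> 0 \<omega>))) borel fst \<Otimes>\<^sub>M distr ?Q (S \<Otimes>\<^sub>M S) (\<lambda>y. (\<lambda>j. fst (y j), \<lambda>j. snd (y j)))"
      using rv[of 0] m g A by (simp add: distr_distr comp_def)
    also have "\<dots> = distr (distr M ?N (\<lambda>\<omega>. (X 1 \<omega>, \<xi> 0 \<omega>)) \<Otimes>\<^sub>M ?Q) (borel \<Otimes>\<^sub>M (S \<Otimes>\<^sub>M S))
        (\<lambda>(p, y). (fst p, (\<lambda>j. fst (y j), \<lambda>j. snd (y j))))"
      using m g by (intro pair_measure_distr prob_space_imp_sigma_finite Q.prob_space_distr) simp_all
    also have "distr M ?N (\<lambda>\<omega>. (X 1 \<omega>, \<xi> 0 \<omega>)) \<Otimes>\<^sub>M ?Q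
      = distr M (?N \<Otimes>\<^sub>M PiM UNIV (\<lambda>_. ?N)) (\<lambda>\<omega>. ((X 1 \<omega>, \<xi> 0 \<omega>), \<lambda>j. (X (Suc (Suc j)) \<omega>, \<xi> (Suc j) \<omega>)))"
      using distr_iid_split[OF ind id] by simp
    also have "distr \<dots> (borel \<Otimes>\<^sub>M (S \<Otimes>\<^sub>M S)) (\<lambda>(p, y). (fst p, (\<lambda>j. fst (y j), \<lambda>j. snd (y j))))
      = distr M (borel \<Otimes>\<^sub>M (S \<Otimes>\<^sub>M S)) (\<lambda>\<omega>. (X 1 \<omega>, (\<lambda>j. X (Suc (Suc j)) \<omega>, \<lambda>j. \<xi> (Suc j) \<omega>)))"
    proof (subst distr_distr)
      show "(\<lambda>(p, y). (fst p, (\<lambda>j. fst (y j), \<lambda>j. snd (y j)))) \<in> ?N \<Otimes>\<^sub>M PiM UNIV (\<lambda>_. ?N) \<rightarrow>\<^sub>M borel \<Otimes>\<^sub>M (S \<Otimes>\<^sub>M S)"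
        unfolding case_prod_beta
        by (intro measurable_Pair measurable_compose[OF measurable_fst m(1)] measurable_compose[OF measurable_snd g])
      show "(\<lambda>\<omega>. ((X 1 \<omega>, \<xi> 0 \<omega>), \<lambda>j. (X (Suc (Suc j)) \<omega>, \<xi> (Suc j) \<omega>))) \<in> M \<rightarrow>\<^sub>M ?N \<Otimes>\<^sub>M PiM UNIV (\<lambda>_. ?N)"
        using rv[of 0] A(2) by (intro measurable_Pair[OF _ A(2)]) simp
    qed (simp add: comp_def)
    finally show ?thesis by simp
  next
    \<comment> \<open>The i.i.d. property splits \<open>X 1\<close> off the steps, stationarity
      identifies the laws of the shifted and unshifted perturbations, and independence of the two
      sequences recombines the factors.\<close>
    assume "indep_stationary_case X \<xi>"
    then have iid: "iid_vars borel X {1..}" and st: "stationary_seq \<xi>"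
      and indep: "indep_var (PiM {1..} (\<lambda>_. borel)) (\<lambda>\<omega>. \<lambda>j\<in>{1..}. X j \<omega>) S (\<lambda>\<omega> j. \<xi> j \<omega>)"
      unfolding indep_stationary_case_def S_def by blast+
    have ind: "indep_vars (\<lambda>_. borel) (\<lambda>j. X (Suc j)) UNIV"
    proof -
      have "indep_vars (\<lambda>_. borel) X (range Suc)"
        using iid unfolding iid_vars_def by (rule indep_vars_subset[OF conjunct1]) auto
      then show ?thesis by (rule indep_vars_reindex) simp
    qed
    have id: "distr M borel (X (Suc j)) = distr M borel (X (Suc 0))" for j
      using iid unfolding iid_vars_def by auto
    have [measurable]: "X (Suc j) \<in> borel_measurable M" for j using ind unfolding indep_vars_def by simp
    have [measurable]: "\<xi> j \<in> borel_measurable M" for j using st unfolding stationary_seq_def by blast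
    define A where "A \<omega> j = X (Suc j) \<omega>" for \<omega> j
    have A[measurable]: "A \<in> M \<rightarrow>\<^sub>M S" unfolding S_def A_def[abs_def] by (rule measurable_PiM_single') auto
    have Xi[measurable]: "(\<lambda>\<omega> j. \<xi> j \<omega>) \<in> M \<rightarrow>\<^sub>M S" unfolding S_def by (rule measurable_PiM_single') auto
    have sh[measurable]: "(\<lambda>f j. f (Suc j)) \<in> S \<rightarrow>\<^sub>M S" unfolding S_def by (rule measurable_seq_shift_UNIV)
    have ev[measurable]: "(\<lambda>f. f 0) \<in> S \<rightarrow>\<^sub>M borel" unfolding S_def by simp
    have shA: "(\<lambda>f j. f (Suc j)) \<in> PiM {1..} (\<lambda>_. borel) \<rightarrow>\<^sub>M S" unfolding S_def by (rule measurable_seq_shift)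
    have Q: "distr M (S \<Otimes>\<^sub>M S) (\<lambda>\<omega>. (A \<omega>, \<lambda>j. \<xi> j \<omega>)) = distr M S A \<Otimes>\<^sub>M distr M S (\<lambda>\<omega> j. \<xi> j \<omega>)"
      using indep_var_distr_pair[OF indep shA measurable_ident_sets[OF refl]] by (simp add: A_def[abs_def])
    have "(\<lambda>f. (f 1, \<lambda>j. f (Suc (Suc j)))) \<in> PiM {1..} (\<lambda>_. borel) \<rightarrow>\<^sub>M borel \<Otimes>\<^sub>M S"
      by (intro measurable_Pair measurable_component_singleton measurable_compose[OF shA sh]) auto
    from indep_var_distr_pair[OF indep this sh]
    have "distr M ((borel \<Otimes>\<^sub>M S) \<Otimes>\<^sub>M S) (\<lambda>\<omega>. ((X 1 \<omega>, \<lambda>j. X (Suc (Suc j)) \<omega>), \<lambda>j. \<xi> (Suc j) \<omega>))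
      = distr M (borel \<Otimes>\<^sub>M S) (\<lambda>\<omega>. (X 1 \<omega>, \<lambda>j. X (Suc (Suc j)) \<omega>)) \<Otimes>\<^sub>M distr M S (\<lambda>\<omega> j. \<xi> (Suc j) \<omega>)"
      by simp
    moreover have "distr M (borel \<Otimes>\<^sub>M S) (\<lambda>\<omega>. (X 1 \<omega>, \<lambda>j. X (Suc (Suc j)) \<omega>)) = distr M borel (X 1) \<Otimes>\<^sub>M distr M S A"
      using distr_iid_split[OF ind id] by (simp add: S_def A_def[abs_def])
    moreover have "distr M S (\<lambda>\<omega> j. \<xi> (Suc j) \<omega>) = distr M S (\<lambda>\<omega> j. \<xi> j \<omega>)"
      using st[unfolded stationary_seq_def, THEN conjunct2, THEN spec, of 1] by (simp add: S_def)
    ultimately have L: "distr M ((borel \<Otimes>\<^sub>M S) \<Otimes>\<^sub>M S) (\<lambda>\<omega>. ((X 1 \<omega>, \<lambda>j. X (Suc (Suc j)) \<omega>), \<lambda>j. \<xi> (Suc j) \<omega>))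
      = (distr M borel (X 1) \<Otimes>\<^sub>M distr M S A) \<Otimes>\<^sub>M distr M S (\<lambda>\<omega> j. \<xi> j \<omega>)" by simp
    let ?g = "\<lambda>p. (fst (fst p), (snd (fst p), snd p))"
    let ?B = "borel :: real measure"
    have sg: "sets S = sets (distr M S A)" "sets S = sets (distr M S (\<lambda>\<omega> j. \<xi> j \<omega>))" "sets ?B = sets (distr M borel (X 1))"
      by simp_all
    have "distr M (borel \<Otimes>\<^sub>M (S \<Otimes>\<^sub>M S)) (\<lambda>\<omega>. (X 1 \<omega>, (\<lambda>j. X (Suc (Suc j)) \<omega>, \<lambda>j. \<xi> (Suc j) \<omega>)))
      = distr (distr M ((borel \<Otimes>\<^sub>M S) \<Otimes>\<^sub>M S) (\<lambda>\<omega>. ((X 1 \<omega>, \<lambda>j. X (Suc (Suc j)) \<omega>), \<lambda>j. \<xi> (Suc j) \<omega>)))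
          (borel \<Otimes>\<^sub>M (S \<Otimes>\<^sub>M S)) ?g"
    proof (subst distr_distr)
      have "(\<lambda>\<omega> j. X (Suc (Suc j)) \<omega>) \<in> M \<rightarrow>\<^sub>M S" "(\<lambda>\<omega> j. \<xi> (Suc j) \<omega>) \<in> M \<rightarrow>\<^sub>M S"
        unfolding S_def by (rule measurable_PiM_single'; auto)+
      then show "(\<lambda>\<omega>. ((X 1 \<omega>, \<lambda>j. X (Suc (Suc j)) \<omega>), \<lambda>j. \<xi> (Suc j) \<omega>)) \<in> M \<rightarrow>\<^sub>M (borel \<Otimes>\<^sub>M S) \<Otimes>\<^sub>M S"
        by (intro measurable_Pair) auto
    qed (auto simp: comp_def)
    also have "\<dots> = distr M borel (X 1) \<Otimes>\<^sub>M (distr M S A \<Otimes>\<^sub>M distr M S (\<lambda>\<omega> j. \<xi> j \<omega>))"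
      unfolding L
      by (subst distr_pair_measure_assoc[symmetric])
        (auto intro!: prob_space_imp_sigma_finite prob_space_distr distr_cong sets_pair_measure_cong)
    finally show ?thesis using Q unfolding A_def[abs_def] by simp
  qed
  then show "distr M (borel \<Otimes>\<^sub>M (S \<Otimes>\<^sub>M S)) (\<lambda>\<omega>. (X 1 \<omega>, (\<lambda>j. X (Suc (Suc j)) \<omega>, \<lambda>j. \<xi> (Suc j) \<omega>)))
       = distr M borel (X 1) \<Otimes>\<^sub>M distr M (S \<Otimes>\<^sub>M S) (\<lambda>\<omega>. (\<lambda>j. X (Suc j) \<omega>, \<lambda>j. \<xi> j \<omega>))"
    and "\<And>j. X (Suc j) \<in> borel_measurable M" and "\<And>j. \<xi> j \<in> borel_measurable M" by blast+
qed

end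

section \<open>Smoothed tails of the perturbed maximum\<close>

text \<open>This removes the smoothing. The function \<open>u t\<close> lies between
  \<open>h d t\<close> and \<open>exp (\<theta> * d) * h d (t - d)\<close>; both converge, and their
  limits come together as \<open>d\<close> decreases to 0.\<close>

lemma tendsto_between_scaled:
  fixes u :: "real \<Rightarrow> real" and h :: "real \<Rightarrow> real \<Rightarrow> real"
  assumes lim: "\<And>d. d > 0 \<Longrightarrow> \<exists>L>0. (h d \<longlongrightarrow> L) at_top"
    and C: "\<And>d t. d > 0 \<Longrightarrow> h d t \<le> C"
    and lower: "\<And>d t. d > 0 \<Longrightarrow> h d t \<le> u t"
    and upper: "\<And>d t. d > 0 \<Longrightarrow> u (t + d) \<le> exp (\<theta> * d) * h d t"
  shows "\<exists>c>0. (u \<longlongrightarrow> c) at_top"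
proof -
  define L where "L d = (SOME L. L > 0 \<and> (h d \<longlongrightarrow> L) at_top)" for d
  have L: "L d > 0" "(h d \<longlongrightarrow> L d) at_top" if "d > 0" for d
    using someI_ex[OF lim[OF that]] unfolding L_def by blast+
  have shift: "filterlim (\<lambda>t::real. t - d) at_top at_top" for d
    using filterlim_shift_at_top[of "- d"] by simp
  have up: "((\<lambda>t. exp (\<theta> * d) * h d (t - d)) \<longlongrightarrow> exp (\<theta> * d) * L d) at_top" if "d > 0" for d
    by (intro tendsto_mult tendsto_const filterlim_compose[OF L(2)[OF that] shift])
  have uh: "u t \<le> exp (\<theta> * d) * h d (t - d)" if "d > 0" for d t using upper[OF that, of "t - d"] by simp
  \<comment> \<open>Lower bounds of \<open>u\<close> at scale \<open>d\<close> are compared with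
    upper bounds at scale \<open>e\<close>. The supremum \<open>c\<close> of all \<open>L d\<close>
    therefore satisfies \<open>L e \<le> c \<le> exp (\<theta> * e) * L e\<close>.\<close>
  have comp: "L d \<le> exp (\<theta> * e) * L e" if "d > 0" "e > 0" for d e
  proof (rule tendsto_le[OF _ up[OF that(2)] L(2)[OF that(1)]])
    show "\<forall>\<^sub>F t in at_top. h d t \<le> exp (\<theta> * e) * h e (t - e)"
      using lower[OF that(1)] uh[OF that(2)] by (intro always_eventually allI) (rule order_trans)
  qed simp
  have LC: "L d \<le> C" if "d > 0" for d
    by (rule tendsto_upperbound[OF L(2)[OF that]]) (use C[OF that] in auto)
  define c where "c = (SUP d\<in>{0<..}. L d)"
  have bdd: "bdd_above (L ` {0<..})" using LC by (intro bdd_aboveI[of _ C]) auto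
  have Lc: "L d \<le> c" if "d > 0" for d unfolding c_def using that by (intro cSUP_upper bdd) auto
  have cL: "c \<le> exp (\<theta> * e) * L e" if "e > 0" for e
    unfolding c_def using comp[OF _ that] by (intro cSUP_least) auto
  have cpos: "c > 0" using L(1)[of 1] Lc[of 1] by simp
  have "((\<lambda>e. exp (\<theta> * e) * c) \<longlongrightarrow> exp (\<theta> * 0) * c) (at_right 0)"
    by (intro tendsto_intros)
  then have e1: "((\<lambda>e. exp (\<theta> * e) * c) \<longlongrightarrow> c) (at_right 0)" by simp
  have "((\<lambda>e. exp (- \<theta> * e) * c) \<longlongrightarrow> exp (- \<theta> * 0) * c) (at_right 0)"
    by (intro tendsto_intros)
  then have e2: "((\<lambda>e. exp (- \<theta> * e) * c) \<longlongrightarrow> c) (at_right 0)" by simp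
  have "(u \<longlongrightarrow> c) at_top"
  proof (rule order_tendstoI)
    fix a assume "c < a"
    have "\<forall>\<^sub>F e in at_right 0. exp (\<theta> * e) * c < a \<and> 0 < e"
      using order_tendstoD(2)[OF e1 \<open>c < a\<close>] eventually_at_right_less by (rule eventually_conj)
    from eventually_happens'[OF trivial_limit_at_right_real this]
    obtain e where e: "e > 0" "exp (\<theta> * e) * c < a" by blast
    have "exp (\<theta> * e) * L e \<le> exp (\<theta> * e) * c" using Lc[OF e(1)] by simp
    then have "\<forall>\<^sub>F t in at_top. exp (\<theta> * e) * h e (t - e) < a"
      using e(2) by (intro order_tendstoD(2)[OF up[OF e(1)]]) linarith
    then show "\<forall>\<^sub>F t in at_top. u t < a"
    proof eventually_elim
      case (elim t)
      then show ?case using uh[OF e(1), of t] by linarith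
    qed
  next
    fix a assume "a < c"
    have "\<forall>\<^sub>F e in at_right 0. a < exp (- \<theta> * e) * c \<and> 0 < e"
      using order_tendstoD(1)[OF e2 \<open>a < c\<close>] eventually_at_right_less by (rule eventually_conj)
    from eventually_happens'[OF trivial_limit_at_right_real this]
    obtain e where e: "e > 0" "a < exp (- \<theta> * e) * c" by blast
    have "exp (- \<theta> * e) * c \<le> exp (- \<theta> * e) * (exp (\<theta> * e) * L e)" using cL[OF e(1)] by simp
    also have "\<dots> = L e" by (simp add: exp_minus)
    finally have "a < L e" using e(2) by linarith
    then have "\<forall>\<^sub>F t in at_top. a < h e t" by (rule order_tendstoD(1)[OF L(2)[OF e(1)]])
    then show "\<forall>\<^sub>F t in at_top. a < u t"
    proof eventually_elim
      case (elim t)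
      then show ?case using lower[OF e(1), of t] by linarith
    qed
  qed
  then show ?thesis using cpos by blast
qed

text \<open>For \<open>d > 0\<close>, a nondecreasing function with Lipschitz constant
  \<open>1 / d\<close>, squeezed between the indicators of \<open>y \<ge> d\<close> and
  \<open>y > 0\<close>.\<close>

definition ramp :: "real \<Rightarrow> real \<Rightarrow> real" where
  "ramp d y = min 1 (max 0 (y / d))"

lemma ramp_nonneg: "0 \<le> ramp d y" and ramp_le_1: "ramp d y \<le> 1"
  by (simp_all add: ramp_def)

lemma ramp_eq_0: "d > 0 \<Longrightarrow> y \<le> 0 \<Longrightarrow> ramp d y = 0"
  by (simp add: ramp_def divide_nonpos_pos)

lemma ramp_eq_1: "d > 0 \<Longrightarrow> d \<le> y \<Longrightarrow> ramp d y = 1"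
  by (simp add: ramp_def)

lemma ramp_mono: "d > 0 \<Longrightarrow> x \<le> y \<Longrightarrow> ramp d x \<le> ramp d y"
  unfolding ramp_def by (intro min.mono max.mono divide_right_mono) auto

lemma ramp_le_shift: assumes "d > 0" "0 \<le> s" shows "ramp d (y + s) \<le> ramp d y + s / d"
proof -
  have "0 \<le> s / d" using assms by simp
  then show ?thesis unfolding ramp_def add_divide_distrib by linarith
qed

lemma measurable_ramp [measurable]: "ramp d \<in> borel_measurable borel"
  unfolding ramp_def[abs_def] by measurable

section \<open>Functionals of a pair of sequences\<close>

abbreviation seqM :: "(nat \<Rightarrow> real) measure" where
  "seqM \<equiv> PiM UNIV (\<lambda>_. borel)"

text \<open>A functional on path space, so that identities between laws of paths can be applied.
  Entry \<open>j\<close> of the first sequence stands for \<open>X (Suc j)\<close>, hence the sum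
  over \<open>j < k\<close>.\<close>

definition pert :: "nat \<Rightarrow> (nat \<Rightarrow> real) \<times> (nat \<Rightarrow> real) \<Rightarrow> real" where
  "pert k q = (\<Sum>j<k. fst q j) + snd q k"

lemma measurable_pert [measurable]: "pert k \<in> borel_measurable (seqM \<Otimes>\<^sub>M seqM)"
  unfolding pert_def[abs_def] by measurable

text \<open>For \<open>d > 0\<close> this is the ramp of the perturbed maximum minus
  \<open>t\<close>, as the ramp is monotone and continuous. A supremum of ramps stays real and
  bounded even where the maximum is infinite.\<close>

definition soft :: "real \<Rightarrow> real \<Rightarrow> (nat \<Rightarrow> real) \<times> (nat \<Rightarrow> real) \<Rightarrow> real" where
  "soft d t q = (SUP k. ramp d (pert k q - t))"

lemma bdd_above_ramp: "bdd_above (range (\<lambda>k. ramp d (f k)))"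
  by (rule bdd_aboveI[of _ 1]) (auto simp: ramp_le_1)

lemma ramp_le_soft: "ramp d (pert k q - t) \<le> soft d t q"
  unfolding soft_def by (intro cSUP_upper bdd_above_ramp) simp

lemma soft_le: "(\<And>k. ramp d (pert k q - t) \<le> c) \<Longrightarrow> soft d t q \<le> c"
  unfolding soft_def by (intro cSUP_least) auto

lemma soft_nonneg: "0 \<le> soft d t q"
  using ramp_nonneg ramp_le_soft by (rule order_trans)

lemma soft_le_1: "soft d t q \<le> 1"
  by (intro soft_le ramp_le_1)

text \<open>Joint in level and path, because the level will be shifted by the random step
  \<open>X 1\<close>.\<close>

lemma measurable_soft [measurable]:
  "(\<lambda>(t, q). soft d t q) \<in> borel_measurable (borel \<Otimes>\<^sub>M (seqM \<Otimes>\<^sub>M seqM))"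
  unfolding soft_def[abs_def] case_prod_beta
  by (rule borel_measurable_cSUP) (auto intro!: bdd_above_ramp)

locale perturbed_walk = prob_space M for M :: "'a measure" +
  fixes X \<xi> :: "nat \<Rightarrow> 'a \<Rightarrow> real" and \<theta> c0 :: real
  assumes X_meas [measurable]: "\<And>j. X (Suc j) \<in> borel_measurable M"
    and xi_meas [measurable]: "\<And>j. \<xi> j \<in> borel_measurable M"
    and split: "distr M (borel \<Otimes>\<^sub>M (seqM \<Otimes>\<^sub>M seqM)) (\<lambda>\<omega>. (X 1 \<omega>, (\<lambda>j. X (Suc (Suc j)) \<omega>, \<lambda>j. \<xi> (Suc j) \<omega>)))
       = distr M borel (X 1) \<Otimes>\<^sub>M distr M (seqM \<Otimes>\<^sub>M seqM) (\<lambda>\<omega>. (\<lambda>j. X (Suc j) \<omega>, \<lambda>j. \<xi> j \<omega>))"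
    and theta: "\<theta> > 0"
    and expX: "integrable M (\<lambda>\<omega>. exp (\<theta> * X 1 \<omega>))" "expectation (\<lambda>\<omega>. exp (\<theta> * X 1 \<omega>)) = 1"
    and xi_le: "AE \<omega> in M. \<xi> 0 \<omega> \<le> c0"
begin

definition traj :: "'a \<Rightarrow> (nat \<Rightarrow> real) \<times> (nat \<Rightarrow> real)" where
  "traj \<omega> = (\<lambda>j. X (Suc j) \<omega>, \<lambda>j. \<xi> j \<omega>)"

text \<open>The path seen after the first step; by \<open>split\<close> it is independent of
  \<open>X 1\<close> and distributed as \<open>traj\<close>.\<close>

definition traj1 :: "'a \<Rightarrow> (nat \<Rightarrow> real) \<times> (nat \<Rightarrow> real)" where
  "traj1 \<omega> = (\<lambda>j. X (Suc (Suc j)) \<omega>, \<lambda>j. \<xi> (Suc j) \<omega>)"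

lemma measurable_X1 [measurable]: "X 1 \<in> borel_measurable M"
  using X_meas[of 0] by simp

lemma measurable_traj [measurable]: "traj \<in> M \<rightarrow>\<^sub>M seqM \<Otimes>\<^sub>M seqM"
  unfolding traj_def[abs_def] by (intro measurable_Pair measurable_PiM_single') auto

lemma measurable_traj1 [measurable]: "traj1 \<in> M \<rightarrow>\<^sub>M seqM \<Otimes>\<^sub>M seqM"
  unfolding traj1_def[abs_def] by (intro measurable_Pair measurable_PiM_single') auto

lemma pert_0: "pert 0 (traj \<omega>) = \<xi> 0 \<omega>"
  by (simp add: pert_def traj_def)

lemma pert_Suc: "pert (Suc k) (traj \<omega>) = X 1 \<omega> + pert k (traj1 \<omega>)"
  unfolding pert_def traj_def traj1_def by (simp add: sum.lessThan_Suc_shift del: sum.lessThan_Suc)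

lemma pert_traj: "pert k (traj \<omega>) = walk X k \<omega> + \<xi> k \<omega>"
proof -
  have "(\<Sum>j<k. X (Suc j) \<omega>) = (\<Sum>j=1..k. X j \<omega>)"
    by (simp add: sum.atLeast1_atMost_eq)
  then show ?thesis by (simp add: pert_def traj_def walk_def)
qed

text \<open>Fubini for the product law in \<open>split\<close>: given \<open>X 1\<close>, the later
  path may be replaced by an independent copy of the whole path.\<close>

lemma expectation_split:
  fixes f :: "real \<times> (nat \<Rightarrow> real) \<times> (nat \<Rightarrow> real) \<Rightarrow> real"
  assumes f[measurable]: "f \<in> borel_measurable (borel \<Otimes>\<^sub>M (seqM \<Otimes>\<^sub>M seqM))" and B: "\<And>p. \<bar>f p\<bar> \<le> B"
  shows "expectation (\<lambda>\<omega>. f (X 1 \<omega>, traj1 \<omega>)) = expectation (\<lambda>\<omega>. expectation (\<lambda>\<omega>'. f (X 1 \<omega>, traj \<omega>')))"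
proof -
  let ?F = "distr M borel (X 1)" and ?Q = "distr M (seqM \<Otimes>\<^sub>M seqM) traj"
  interpret F: prob_space ?F by (rule prob_space_distr) measurable
  interpret Q: prob_space ?Q by (rule prob_space_distr) measurable
  interpret P: pair_prob_space ?F ?Q ..
  have s: "distr M (borel \<Otimes>\<^sub>M (seqM \<Otimes>\<^sub>M seqM)) (\<lambda>\<omega>. (X 1 \<omega>, traj1 \<omega>)) = ?F \<Otimes>\<^sub>M ?Q"
    using split by (simp add: traj_def[abs_def] traj1_def[abs_def])
  have m: "f \<in> borel_measurable (?F \<Otimes>\<^sub>M ?Q)" by measurable
  have int: "integrable (?F \<Otimes>\<^sub>M ?Q) f" by (rule P.integrable_const_bound[of _ B]) (use B m in auto)
  have "expectation (\<lambda>\<omega>. f (X 1 \<omega>, traj1 \<omega>)) = integral\<^sup>L (?F \<Otimes>\<^sub>M ?Q) f"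
    unfolding s[symmetric] by (rule integral_distr[symmetric]) measurable
  also have "\<dots> = (\<integral>x. \<integral>q. f (x, q) \<partial>?Q \<partial>?F)"
    using P.integral_fst'[OF int] by simp
  also have "\<dots> = (\<integral>x. expectation (\<lambda>\<omega>'. f (x, traj \<omega>')) \<partial>?F)"
    by (intro Bochner_Integration.integral_cong refl integral_distr) measurable
  also have "\<dots> = expectation (\<lambda>\<omega>. expectation (\<lambda>\<omega>'. f (X 1 \<omega>, traj \<omega>')))"
    by (rule integral_distr) measurable
  finally show ?thesis .
qed

text \<open>The existential form keeps the extended reals out of the argument;
  \<open>tail_eq\<close> links it to \<open>perturbed_max\<close>.\<close>

definition tail :: "real \<Rightarrow> real" where
  "tail t = prob {\<omega> \<in> space M. \<exists>k. t < pert k (traj \<omega>)}"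

text \<open>Lundberg's inequality by induction on the horizon, uniformly in \<open>t\<close>. Below
  \<open>c0\<close> the bound is at least 1. From \<open>c0\<close> on, time 0 almost surely cannot
  exceed the level, so the first step can be split off.\<close>

lemma finite_tail_bound: "prob {\<omega> \<in> space M. \<exists>k\<le>n. t < pert k (traj \<omega>)} \<le> exp (- \<theta> * (t - c0))"
proof (induction n arbitrary: t)
  case 0
  show ?case
  proof (cases "t < c0")
    case True
    then have "1 \<le> exp (- \<theta> * (t - c0))" using theta by (simp add: mult_pos_neg less_imp_le mult_le_0_iff)
    then show ?thesis using prob_le_1 order_trans by blast
  next
    case False
    have "AE \<omega> in M. \<not> (\<exists>k\<le>0. t < pert k (traj \<omega>))"
      using xi_le by eventually_elim (use False in \<open>auto simp: pert_0\<close>)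
    then have "prob {\<omega> \<in> space M. \<exists>k\<le>0. t < pert k (traj \<omega>)} = 0" by (intro prob_eq_0_AE)
    then show ?thesis by simp
  qed
next
  case (Suc n)
  show ?case
  proof (cases "t < c0")
    case True
    then have "1 \<le> exp (- \<theta> * (t - c0))" using theta by (simp add: mult_pos_neg less_imp_le mult_le_0_iff)
    then show ?thesis using prob_le_1 order_trans by blast
  next
    case False
    define f :: "real \<times> (nat \<Rightarrow> real) \<times> (nat \<Rightarrow> real) \<Rightarrow> real"
      where "f p = (if \<exists>k\<le>n. t < fst p + pert k (snd p) then 1 else 0)" for p
    have [measurable]: "f \<in> borel_measurable (borel \<Otimes>\<^sub>M (seqM \<Otimes>\<^sub>M seqM))"
      unfolding f_def[abs_def] by measurable
    have ie: "expectation (\<lambda>\<omega>. f (x, g \<omega>)) = prob {\<omega> \<in> space M. \<exists>k\<le>n. t - x < pert k (g \<omega>)}"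
      if [measurable]: "g \<in> M \<rightarrow>\<^sub>M seqM \<Otimes>\<^sub>M seqM" for x g
    proof -
      have "expectation (\<lambda>\<omega>. f (x, g \<omega>)) = expectation (indicator {\<omega> \<in> space M. \<exists>k\<le>n. t - x < pert k (g \<omega>)})"
        by (intro Bochner_Integration.integral_cong) (auto simp: f_def indicator_def algebra_simps)
      then show ?thesis by simp
    qed
    have "prob {\<omega> \<in> space M. \<exists>k\<le>Suc n. t < pert k (traj \<omega>)} = expectation (indicator {\<omega> \<in> space M. \<exists>k\<le>Suc n. t < pert k (traj \<omega>)})"
      by simp
    also have "\<dots> \<le> expectation (\<lambda>\<omega>. f (X 1 \<omega>, traj1 \<omega>))"
    proof (rule integral_mono_AE)
      show "AE \<omega> in M. indicator {\<omega> \<in> space M. \<exists>k\<le>Suc n. t < pert k (traj \<omega>)} \<omega> \<le> f (X 1 \<omega>, traj1 \<omega>)"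
        using xi_le
      proof eventually_elim
        case (elim \<omega>)
        have "\<exists>k\<le>n. t < X 1 \<omega> + pert k (traj1 \<omega>)" if "k \<le> Suc n" "t < pert k (traj \<omega>)" for k
        proof (cases k)
          case 0 then show ?thesis using that elim False by (simp add: pert_0)
        next
          case (Suc j) then show ?thesis using that pert_Suc[of j \<omega>] by auto
        qed
        then show ?case by (auto simp: indicator_def f_def)
      qed
      show "integrable M (\<lambda>\<omega>. f (X 1 \<omega>, traj1 \<omega>))"
        by (rule integrable_const_bound[of _ 1]) (auto simp: f_def)
    qed (auto intro!: integrable_real_indicator simp: emeasure_eq_measure)
    also have "\<dots> = expectation (\<lambda>\<omega>. expectation (\<lambda>\<omega>'. f (X 1 \<omega>, traj \<omega>')))"
      by (rule expectation_split[of _ 1]) (auto simp: f_def)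
    \<comment> \<open>The induction hypothesis at level \<open>t - X 1\<close>. Since
      \<open>exp (\<theta> * X 1)\<close> has mean 1, the bound reproduces itself with the same
      constant.\<close>
    also have "\<dots> \<le> expectation (\<lambda>\<omega>. exp (- \<theta> * (t - c0)) * exp (\<theta> * X 1 \<omega>))"
    proof (rule integral_mono)
      have "(\<lambda>\<omega>. expectation (\<lambda>\<omega>'. f (X 1 \<omega>, traj \<omega>'))) \<in> borel_measurable M" by measurable
      then show "integrable M (\<lambda>\<omega>. expectation (\<lambda>\<omega>'. f (X 1 \<omega>, traj \<omega>')))"
        by (intro integrable_const_bound[of _ 1]) (auto simp: ie[OF measurable_traj])
      fix \<omega>
      show "expectation (\<lambda>\<omega>'. f (X 1 \<omega>, traj \<omega>')) \<le> exp (- \<theta> * (t - c0)) * exp (\<theta> * X 1 \<omega>)"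
        unfolding ie[OF measurable_traj]
        using Suc.IH[of "t - X 1 \<omega>"] by (simp add: exp_add[symmetric] algebra_simps)
    qed (use expX in auto)
    also have "\<dots> = exp (- \<theta> * (t - c0))" using expX by simp
    finally show ?thesis .
  qed
qed

lemma tail_bound: "tail t \<le> exp (- \<theta> * (t - c0))"
proof -
  let ?A = "\<lambda>n. {\<omega> \<in> space M. \<exists>k\<le>n. t < pert k (traj \<omega>)}"
  have "(\<lambda>n. prob (?A n)) \<longlonglongrightarrow> prob (\<Union>n. ?A n)"
    by (rule finite_Lim_measure_incseq) (auto simp: incseq_def intro: order_trans)
  moreover have "(\<Union>n. ?A n) = {\<omega> \<in> space M. \<exists>k. t < pert k (traj \<omega>)}" by auto
  ultimately have "(\<lambda>n. prob (?A n)) \<longlonglongrightarrow> tail t" by (simp add: tail_def)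
  then show ?thesis by (rule LIMSEQ_le_const2) (use finite_tail_bound in blast)
qed

lemma tail_nonneg: "0 \<le> tail t" by (simp add: tail_def)

section \<open>The smoothed tail and its one-step relation\<close>

definition stail :: "real \<Rightarrow> real \<Rightarrow> real" where
  "stail d t = expectation (\<lambda>\<omega>. soft d t (traj \<omega>))"

lemma measurable_soft_comp [measurable]:
  assumes "f \<in> borel_measurable N" "g \<in> N \<rightarrow>\<^sub>M seqM \<Otimes>\<^sub>M seqM"
  shows "(\<lambda>x. soft d (f x) (g x)) \<in> borel_measurable N"
  using measurable_compose[OF measurable_Pair[OF assms] measurable_soft] by simp

lemma integrable_soft: "g \<in> M \<rightarrow>\<^sub>M seqM \<Otimes>\<^sub>M seqM \<Longrightarrow> f \<in> borel_measurable M \<Longrightarrow> integrable M (\<lambda>\<omega>. soft d (f \<omega>) (g \<omega>))"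
  by (rule integrable_const_bound[of _ 1]) (auto simp: soft_nonneg soft_le_1)

lemma stail_nonneg: "0 \<le> stail d t"
  unfolding stail_def by (intro integral_nonneg_AE AE_I2 soft_nonneg)

lemma stail_le_1: "stail d t \<le> 1"
  unfolding stail_def using prob_space
  by (intro integral_le_const integrable_soft AE_I2 soft_le_1) auto

lemma stail_le_tail: assumes d: "d > 0" shows "stail d t \<le> tail t"
proof -
  have "stail d t \<le> expectation (indicator {\<omega> \<in> space M. \<exists>k. t < pert k (traj \<omega>)})"
    unfolding stail_def
  proof (rule integral_mono)
    fix \<omega> assume "\<omega> \<in> space M"
    then show "soft d t (traj \<omega>) \<le> indicator {\<omega> \<in> space M. \<exists>k. t < pert k (traj \<omega>)} \<omega>"
      by (cases "\<exists>k. t < pert k (traj \<omega>)") (auto simp: soft_le_1 not_less ramp_eq_0[OF d] intro!: soft_le)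
  qed (auto intro!: integrable_soft integrable_real_indicator simp: emeasure_eq_measure)
  then show ?thesis by (simp add: tail_def)
qed

lemma tail_le_stail: assumes d: "d > 0" shows "tail (t + d) \<le> stail d t"
proof -
  have "expectation (indicator {\<omega> \<in> space M. \<exists>k. t + d < pert k (traj \<omega>)}) \<le> stail d t"
    unfolding stail_def
  proof (rule integral_mono)
    fix \<omega> assume "\<omega> \<in> space M"
    have "1 \<le> soft d t (traj \<omega>)" if "t + d < pert k (traj \<omega>)" for k
      using ramp_le_soft[of d k "traj \<omega>" t] ramp_eq_1[OF d, of "pert k (traj \<omega>) - t"] that by simp
    then show "indicator {\<omega> \<in> space M. \<exists>k. t + d < pert k (traj \<omega>)} \<omega> \<le> soft d t (traj \<omega>)"
      by (auto simp: indicator_def soft_nonneg)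
  qed (auto intro!: integrable_soft integrable_real_indicator simp: emeasure_eq_measure)
  then show ?thesis by (simp add: tail_def)
qed

lemma stail_antimono:
  assumes d: "d > 0" and st: "s \<le> t" shows "stail d t \<le> stail d s"
  unfolding stail_def
proof (intro integral_mono integrable_soft soft_le)
  fix \<omega> k
  have "ramp d (pert k (traj \<omega>) - t) \<le> ramp d (pert k (traj \<omega>) - s)"
    using st by (intro ramp_mono d) simp
  also have "\<dots> \<le> soft d s (traj \<omega>)" by (rule ramp_le_soft)
  finally show "ramp d (pert k (traj \<omega>) - t) \<le> soft d s (traj \<omega>)" .
qed auto

text \<open>Moving the level matters only on paths that exceed \<open>s\<close>. The factor
  \<open>tail s\<close> keeps the bound of order \<open>exp (- \<theta> * s)\<close>, as the
  Lipschitz bound after scaling requires.\<close>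

lemma stail_diff_le:
  assumes d: "d > 0" and st: "s \<le> t" shows "stail d s - stail d t \<le> (t - s) / d * tail s"
proof -
  let ?I = "indicator {\<omega> \<in> space M. \<exists>k. s < pert k (traj \<omega>)} :: 'a \<Rightarrow> real"
  have iI: "integrable M ?I" by (auto intro!: integrable_real_indicator simp: emeasure_eq_measure)
  have "stail d s \<le> expectation (\<lambda>\<omega>. soft d t (traj \<omega>) + (t - s) / d * ?I \<omega>)"
    unfolding stail_def
  proof (rule integral_mono)
    fix \<omega> assume \<omega>: "\<omega> \<in> space M"
    show "soft d s (traj \<omega>) \<le> soft d t (traj \<omega>) + (t - s) / d * ?I \<omega>"
    proof (rule soft_le)
      fix k
      show "ramp d (pert k (traj \<omega>) - s) \<le> soft d t (traj \<omega>) + (t - s) / d * ?I \<omega>"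
      proof (cases "s < pert k (traj \<omega>)")
        case True
        then have "?I \<omega> = 1" using \<omega> unfolding indicator_def by auto
        moreover have "ramp d (pert k (traj \<omega>) - s) \<le> ramp d (pert k (traj \<omega>) - t) + (t - s) / d"
          using ramp_le_shift[OF d, of "t - s" "pert k (traj \<omega>) - t"] st by simp
        ultimately show ?thesis using ramp_le_soft[of d k "traj \<omega>" t] by simp
      next
        case False
        then have "ramp d (pert k (traj \<omega>) - s) = 0" by (intro ramp_eq_0 d) simp
        moreover have "0 \<le> (t - s) / d * ?I \<omega>" using d st by simp
        ultimately show ?thesis using soft_nonneg[of d t "traj \<omega>"] by linarith
      qed
    qed
  qed (intro integrable_soft Bochner_Integration.integrable_add integrable_mult_right iI; measurable)+
  also have "\<dots> = stail d t + (t - s) / d * tail s"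
    using iI integrable_soft[OF measurable_traj, of "\<lambda>_. t"] by (simp add: stail_def tail_def)
  finally show ?thesis by simp
qed

text \<open>The terms \<open>k \<ge> 1\<close> of \<open>soft d t\<close> at \<open>traj\<close> are
  the terms of \<open>soft d (t - X 1)\<close> at \<open>traj1\<close>. Only \<open>k = 0\<close> is
  lost, and its ramp is almost surely 0 once \<open>t \<ge> c0\<close>.\<close>

lemma stail_step:
  assumes d: "d > 0"
  shows "expectation (\<lambda>\<omega>. stail d (t - X 1 \<omega>)) \<le> stail d t"
    and "c0 \<le> t \<Longrightarrow> expectation (\<lambda>\<omega>. stail d (t - X 1 \<omega>)) = stail d t"
proof -
  have eq: "expectation (\<lambda>\<omega>. stail d (t - X 1 \<omega>)) = expectation (\<lambda>\<omega>. soft d (t - X 1 \<omega>) (traj1 \<omega>))"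
    unfolding stail_def
    using expectation_split[of "\<lambda>p. soft d (t - fst p) (snd p)" 1] by (simp add: soft_nonneg soft_le_1)
  have ge: "soft d (t - X 1 \<omega>) (traj1 \<omega>) \<le> soft d t (traj \<omega>)" for \<omega>
  proof (rule soft_le)
    fix k
    show "ramp d (pert k (traj1 \<omega>) - (t - X 1 \<omega>)) \<le> soft d t (traj \<omega>)"
      using ramp_le_soft[of d "Suc k" "traj \<omega>" t] by (simp add: pert_Suc algebra_simps)
  qed
  show "expectation (\<lambda>\<omega>. stail d (t - X 1 \<omega>)) \<le> stail d t"
    unfolding eq unfolding stail_def by (intro integral_mono integrable_soft ge) measurable
  assume t: "c0 \<le> t"
  have "AE \<omega> in M. soft d (t - X 1 \<omega>) (traj1 \<omega>) = soft d t (traj \<omega>)"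
    using xi_le
  proof eventually_elim
    case (elim \<omega>)
    have "soft d t (traj \<omega>) \<le> soft d (t - X 1 \<omega>) (traj1 \<omega>)"
    proof (rule soft_le)
      fix k
      show "ramp d (pert k (traj \<omega>) - t) \<le> soft d (t - X 1 \<omega>) (traj1 \<omega>)"
      proof (cases k)
        case 0
        then show ?thesis using elim t ramp_eq_0[OF d, of "\<xi> 0 \<omega> - t"] by (simp add: pert_0 soft_nonneg)
      next
        case (Suc j)
        then show ?thesis using ramp_le_soft[of d j "traj1 \<omega>" "t - X 1 \<omega>"] by (simp add: pert_Suc algebra_simps)
      qed
    qed
    then show ?case using ge[of \<omega>] by simp
  qed
  then show "expectation (\<lambda>\<omega>. stail d (t - X 1 \<omega>)) = stail d t"
    unfolding eq unfolding stail_def by (intro integral_cong_AE) measurable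
qed

end

section \<open>Exponential tilting\<close>

text \<open>Exponential moments on an interval around \<theta> give the tilted step a finite
  mean.\<close>

locale cramer_walk = perturbed_walk M X \<xi> \<theta> c0 for M :: "'a measure" and X \<xi> \<theta> c0 +
  fixes \<epsilon> :: real
  assumes eps: "\<epsilon> > 0"
    and expint: "\<And>s. \<bar>s - \<theta>\<bar> < \<epsilon> \<Longrightarrow> integrable M (\<lambda>\<omega>. exp (s * X 1 \<omega>))"
    and nonlat: "nonlattice (X 1)"
begin

text \<open>The Esscher transform of the law of \<open>X 1\<close>; its total mass is 1 because
  \<open>exp (\<theta> * X 1)\<close> has mean 1.\<close>

definition tilt :: "real measure" where
  "tilt = density (distr M borel (X 1)) (\<lambda>x. ennreal (exp (\<theta> * x)))"

lemma integral_tilt: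
  fixes f :: "real \<Rightarrow> real"
  assumes [measurable]: "f \<in> borel_measurable borel"
  shows "integrable tilt f \<longleftrightarrow> integrable M (\<lambda>\<omega>. exp (\<theta> * X 1 \<omega>) * f (X 1 \<omega>))"
    and "(\<integral>x. f x \<partial>tilt) = expectation (\<lambda>\<omega>. exp (\<theta> * X 1 \<omega>) * f (X 1 \<omega>))"
  unfolding tilt_def
  by (simp_all add: integrable_density integral_density integrable_distr_eq integral_distr)

text \<open>The density is strictly positive, so tilting does not change the null sets. The
  nonlattice property survives for this reason.\<close>

lemma AE_tilt: "Measurable.pred borel P \<Longrightarrow> (AE x in tilt. P x) \<longleftrightarrow> (AE \<omega> in M. P (X 1 \<omega>))"
  unfolding tilt_def by (simp add: AE_density AE_distr_iff)

sublocale T: real_distribution tilt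
proof (intro real_distribution.intro real_distribution_axioms.intro prob_spaceI)
  have "emeasure tilt (space tilt) = (\<integral>\<^sup>+\<omega>. ennreal (exp (\<theta> * X 1 \<omega>)) \<partial>M)"
    unfolding tilt_def by (simp add: emeasure_density nn_integral_distr)
  also have "\<dots> = 1" using expX by (subst nn_integral_eq_integral) auto
  finally show "emeasure tilt (space tilt) = 1" .
qed (simp add: tilt_def)

lemma nonlattice_AE:
  assumes "d > 0" shows "\<not> (AE \<omega> in M. X 1 \<omega> \<in> range (\<lambda>k::int. d * of_int k))"
proof
  assume AE: "AE \<omega> in M. X 1 \<omega> \<in> range (\<lambda>k::int. d * of_int k)"
  have "{\<omega> \<in> space M. \<exists>k::int. X 1 \<omega> = d * of_int k} \<in> events" by measurable
  then have "prob {\<omega> \<in> space M. \<exists>k::int. X 1 \<omega> = d * of_int k} = 1"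
  proof (subst prob_eq_1)
    show "AE \<omega> in M. \<omega> \<in> {\<omega> \<in> space M. \<exists>k::int. X 1 \<omega> = d * of_int k}"
      using AE AE_space by eventually_elim (simp add: image_iff)
  qed
  with assms have "\<exists>d>0. prob {\<omega> \<in> space M. \<exists>k::int. X 1 \<omega> = d * of_int k} = 1" by (intro exI conjI)
  with nonlat show False unfolding nonlattice_def by (rule notE)
qed

lemma nonlattice_tilt:
  assumes "d > 0" shows "\<not> (AE x in tilt. x \<in> range (\<lambda>k::int. d * of_int k))"
proof -
  have "range (\<lambda>k::int. d * of_int k) \<in> sets borel"
    by (rule sets.countable) simp_all
  then have p: "Measurable.pred borel (\<lambda>x. x \<in> range (\<lambda>k::int. d * of_int k))" by simp
  show ?thesis unfolding AE_tilt[OF p] by (rule nonlattice_AE[OF assms])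
qed

text \<open>From \<open>\<bar>y\<bar> \<le> exp y + exp (- y)\<close> with \<open>y\<close> equal to
  half of \<epsilon> times the step; both exponents \<theta> + \<epsilon> / 2 and \<theta> -
  \<epsilon> / 2 lie in the interval of finite moments.\<close>

lemma integrable_exp_mult: "integrable M (\<lambda>\<omega>. exp (\<theta> * X 1 \<omega>) * X 1 \<omega>)"
proof (rule Bochner_Integration.integrable_bound)
  let ?e = "\<epsilon> / 2"
  show "integrable M (\<lambda>\<omega>. (exp ((\<theta> + ?e) * X 1 \<omega>) + exp ((\<theta> - ?e) * X 1 \<omega>)) / ?e)"
    using eps by (intro integrable_divide Bochner_Integration.integrable_add expint) auto
  show "AE \<omega> in M. norm (exp (\<theta> * X 1 \<omega>) * X 1 \<omega>) \<le> norm ((exp ((\<theta> + ?e) * X 1 \<omega>) + exp ((\<theta> - ?e) * X 1 \<omega>)) / ?e)"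
  proof (rule AE_I2)
    fix \<omega>
    define x where "x = X 1 \<omega>"
    have "\<bar>?e * x\<bar> \<le> exp \<bar>?e * x\<bar>" using exp_ge_add_one_self[of "\<bar>?e * x\<bar>"] by linarith
    also have "\<dots> \<le> exp (?e * x) + exp (- (?e * x))" by (cases "0 \<le> ?e * x") auto
    finally have "?e * \<bar>x\<bar> \<le> exp (?e * x) + exp (- (?e * x))" using eps by (simp add: abs_mult)
    then have "exp (\<theta> * x) * (?e * \<bar>x\<bar>) \<le> exp (\<theta> * x) * (exp (?e * x) + exp (- (?e * x)))"
      by (intro mult_left_mono) auto
    also have "\<dots> = exp ((\<theta> + ?e) * x) + exp ((\<theta> - ?e) * x)"
    proof -
      have "exp ((\<theta> + ?e) * x) = exp (\<theta> * x) * exp (?e * x)" by (simp only: distrib_right exp_add)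
      moreover have "(\<theta> - ?e) * x = \<theta> * x + - (?e * x)" by (simp add: left_diff_distrib)
      then have "exp ((\<theta> - ?e) * x) = exp (\<theta> * x) * exp (- (?e * x))" by (simp only: exp_add)
      ultimately show ?thesis by (simp only: distrib_left)
    qed
    finally have "exp (\<theta> * x) * \<bar>x\<bar> \<le> (exp ((\<theta> + ?e) * x) + exp ((\<theta> - ?e) * x)) / ?e"
      using eps by (simp add: pos_le_divide_eq mult_ac)
    then show "norm (exp (\<theta> * X 1 \<omega>) * X 1 \<omega>) \<le> norm ((exp ((\<theta> + ?e) * X 1 \<omega>) + exp ((\<theta> - ?e) * X 1 \<omega>)) / ?e)"
      unfolding x_def[symmetric] real_norm_def using eps by (simp add: abs_mult)
  qed
qed measurable

text \<open>The integrand \<open>exp y * y - exp y + 1\<close> with \<open>y = \<theta> * X 1\<close> is nonnegative and vanishes only at \<open>y = 0\<close>.\<close>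

lemma tilt_mean_pos: "(\<integral>x. x \<partial>tilt) > 0"
proof -
  define f where "f \<omega> = exp (\<theta> * X 1 \<omega>) * (\<theta> * X 1 \<omega>) - exp (\<theta> * X 1 \<omega>) + 1" for \<omega>
  have f_eq: "f \<omega> = \<theta> * (exp (\<theta> * X 1 \<omega>) * X 1 \<omega>) - exp (\<theta> * X 1 \<omega>) + 1" for \<omega> by (simp add: f_def)
  have f0: "0 \<le> f \<omega>" and fpos: "X 1 \<omega> \<noteq> 0 \<Longrightarrow> 0 < f \<omega>" for \<omega>
  proof -
    define y where "y = \<theta> * X 1 \<omega>"
    \<comment> \<open>With \<open>exp y\<close> factored out, this is the tangent inequality for the
      exponential, strict away from 0.\<close>
    have f: "f \<omega> = exp y * (exp (- y) - (1 - y))" by (simp add: f_def y_def algebra_simps exp_minus)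
    have "1 + - y \<le> exp (- y)" by (rule exp_ge_add_one_self)
    then show "0 \<le> f \<omega>" unfolding f by simp
    assume "X 1 \<omega> \<noteq> 0"
    then have "- y \<noteq> 0" using theta by (simp add: y_def)
    from exp_minus_greater[of y] this show "0 < f \<omega>" unfolding f by simp
  qed
  have int: "integrable M f" unfolding f_eq[abs_def]
    using integrable_exp_mult expX by auto
  \<comment> \<open>The terms \<open>- exp (\<theta> * X 1)\<close> and \<open>1\<close> cancel in
    the mean.\<close>
  have "expectation f = \<theta> * (\<integral>x. x \<partial>tilt)"
    unfolding f_eq[abs_def] integral_tilt(2)[of "\<lambda>x. x", OF measurable_ident_sets[OF refl]]
    using integrable_exp_mult expX prob_space by simp
  moreover have "expectation f \<noteq> 0"
  proof
    assume "expectation f = 0"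
    then have "AE \<omega> in M. f \<omega> = 0" using integral_nonneg_eq_0_iff_AE[OF int] f0 by auto
    \<comment> \<open>A vanishing mean would force \<open>X 1 = 0\<close> almost surely, which is
      lattice with span 1.\<close>
    then have "AE \<omega> in M. X 1 \<omega> \<in> range (\<lambda>k::int. 1 * of_int k)"
    proof eventually_elim
      case (elim \<omega>)
      then have "X 1 \<omega> = 1 * of_int 0" using fpos[of \<omega>] by (cases "X 1 \<omega> = 0") auto
      then show ?case by (rule range_eqI)
    qed
    then show False using nonlattice_AE[of 1] by simp
  qed
  moreover have "0 \<le> expectation f" using f0 by (intro integral_nonneg_AE) auto
  ultimately have "0 < \<theta> * (\<integral>x. x \<partial>tilt)" by linarith
  then show ?thesis using theta by (simp add: zero_less_mult_iff)
qed

text \<open>\<open>\<xi> 0\<close> is finite, so the events that the maximum exceeds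
  \<open>- n\<close> exhaust the space and cannot all be null. This excludes the zero function in
  the renewal theorem.\<close>

lemma tail_pos: "\<exists>t. tail t > 0"
proof (rule ccontr)
  assume "\<nexists>t. tail t > 0"
  then have "\<not> 0 < tail t" for t by blast
  then have t0: "tail t = 0" for t using tail_nonneg[of t] by (metis order_le_less)
  have "AE \<omega> in M. \<not> (\<exists>k. t < pert k (traj \<omega>))" for t
  proof -
    have "AE \<omega> in M. \<omega> \<notin> {\<omega> \<in> space M. \<exists>k. t < pert k (traj \<omega>)}"
      using t0[of t] unfolding tail_def by (subst (asm) prob_eq_0) simp_all
    then show ?thesis using AE_space by eventually_elim simp
  qed
  then have "AE \<omega> in M. \<forall>n::nat. \<not> (\<exists>k. - real n < pert k (traj \<omega>))"
    unfolding AE_all_countable by blast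
  then have "AE \<omega> in M. False"
  proof eventually_elim
    case (elim \<omega>)
    obtain n where "- pert 0 (traj \<omega>) < real n" using reals_Archimedean2 by blast
    then have "- real n < pert 0 (traj \<omega>)" by linarith
    then show ?case using elim by blast
  qed
  then show False by simp
qed

section \<open>The scaled smoothed tail (\<open>h\<close> in the overview) and its limit\<close>

definition scaled :: "real \<Rightarrow> real \<Rightarrow> real" where
  "scaled d t = exp (\<theta> * t) * stail d t"

lemma scaled_tail_le: "exp (\<theta> * t) * tail t \<le> exp (\<theta> * c0)"
proof -
  have "exp (\<theta> * t) * tail t \<le> exp (\<theta> * t) * exp (- \<theta> * (t - c0))"
    by (intro mult_left_mono tail_bound) simp
  also have "\<dots> = exp (\<theta> * c0)" by (simp add: exp_add[symmetric] algebra_simps)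
  finally show ?thesis .
qed

lemma scaled_le_tail: "d > 0 \<Longrightarrow> scaled d t \<le> exp (\<theta> * t) * tail t"
  unfolding scaled_def by (intro mult_left_mono stail_le_tail) auto

lemma scaled_nonneg: "0 \<le> scaled d t"
  unfolding scaled_def by (simp add: stail_nonneg)

lemma scaled_le: "d > 0 \<Longrightarrow> scaled d t \<le> exp (\<theta> * c0)"
  using scaled_le_tail scaled_tail_le by (rule order_trans)

text \<open>The exponential factor contributes \<theta> to the constant and the smoothed tail
  contributes \<open>1 / d\<close>; Lundberg's inequality bounds both contributions by multiples of
  \<open>exp (\<theta> * c0)\<close>.\<close>

lemma scaled_lipschitz:
  assumes d: "d > 0"
  shows "\<bar>scaled d s - scaled d t\<bar> \<le> exp (\<theta> * c0) * (\<theta> + 1 / d) * \<bar>s - t\<bar>"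
proof -
  let ?C = "exp (\<theta> * c0)"
  have *: "\<bar>scaled d s - scaled d t\<bar> \<le> ?C * (\<theta> + 1 / d) * (t - s)" if st: "s \<le> t" for s t
  proof -
    \<comment> \<open>A difference of two nonnegative terms, each bounded separately.\<close>
    have "scaled d t - scaled d s = (exp (\<theta> * t) - exp (\<theta> * s)) * stail d t - exp (\<theta> * s) * (stail d s - stail d t)"
      by (simp add: scaled_def algebra_simps)
    moreover have "0 \<le> (exp (\<theta> * t) - exp (\<theta> * s)) * stail d t"
      using st theta by (intro mult_nonneg_nonneg stail_nonneg) simp
    moreover have "(exp (\<theta> * t) - exp (\<theta> * s)) * stail d t \<le> ?C * \<theta> * (t - s)"
    proof -
      have "1 - exp (\<theta> * s - \<theta> * t) \<le> \<theta> * (t - s)"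
        using exp_ge_add_one_self[of "\<theta> * s - \<theta> * t"] by (simp add: algebra_simps)
      then have "scaled d t * (1 - exp (\<theta> * s - \<theta> * t)) \<le> ?C * (\<theta> * (t - s))"
        using st theta by (intro mult_mono scaled_le d) auto
      also have "scaled d t * (1 - exp (\<theta> * s - \<theta> * t)) = (exp (\<theta> * t) - exp (\<theta> * s)) * stail d t"
        by (simp add: scaled_def exp_diff field_simps)
      finally show ?thesis by (simp add: mult_ac)
    qed
    moreover have "0 \<le> exp (\<theta> * s) * (stail d s - stail d t)"
      using stail_antimono[OF d st] by simp
    moreover have "exp (\<theta> * s) * (stail d s - stail d t) \<le> ?C * (1 / d) * (t - s)"
    proof -
      have "exp (\<theta> * s) * (stail d s - stail d t) \<le> exp (\<theta> * s) * ((t - s) / d * tail s)"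
        by (intro mult_left_mono stail_diff_le d st) simp
      also have "\<dots> = (t - s) / d * (exp (\<theta> * s) * tail s)" by simp
      also have "\<dots> \<le> (t - s) / d * ?C"
        using st d by (intro mult_left_mono scaled_tail_le) simp
      finally show ?thesis by (simp add: mult_ac)
    qed
    moreover have "?C * (\<theta> + 1 / d) * (t - s) = ?C * \<theta> * (t - s) + ?C * (1 / d) * (t - s)"
      by (simp add: distrib_left distrib_right)
    ultimately show ?thesis by linarith
  qed
  show ?thesis
  proof (cases "s \<le> t")
    case True
    then show ?thesis using *[OF True] by simp
  next
    case False
    then have "t \<le> s" by simp
    from *[OF this] False show ?thesis by (simp add: abs_minus_commute)
  qed
qed

text \<open>The tilting weight \<open>exp (\<theta> * X 1)\<close> cancels the shift in
  \<open>exp (\<theta> * (t - X 1))\<close>, so the tilted average is the plain expectation times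
  \<open>exp (\<theta> * t)\<close>.\<close>

lemma avg_scaled:
  "T.avg (scaled d) t = exp (\<theta> * t) * expectation (\<lambda>\<omega>. stail d (t - X 1 \<omega>))"
proof -
  have [measurable]: "stail d \<in> borel_measurable borel" unfolding stail_def[abs_def] by measurable
  have "T.avg (scaled d) t = expectation (\<lambda>\<omega>. exp (\<theta> * X 1 \<omega>) * scaled d (t - X 1 \<omega>))"
    unfolding T.avg_def by (rule integral_tilt(2)) (simp add: scaled_def[abs_def])
  also have "\<dots> = expectation (\<lambda>\<omega>. exp (\<theta> * t) * stail d (t - X 1 \<omega>))"
    by (intro Bochner_Integration.integral_cong) (auto simp: scaled_def exp_add[symmetric] algebra_simps)
  finally show ?thesis by simp
qed

lemma scaled_limit:
  assumes d: "d > 0" shows "\<exists>L>0. (scaled d \<longlongrightarrow> L) at_top"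
proof -
  obtain t where "tail t > 0" using tail_pos by blast
  \<comment> \<open>The shift by \<open>d\<close> is the one in \<open>tail_le_stail\<close>:
    \<open>stail d (t - d)\<close> is at least \<open>tail t\<close>.\<close>
  then have ne: "scaled d (t - d) \<noteq> 0" using tail_le_stail[OF d, of "t - d"] by (simp add: scaled_def)
  have step: "T.avg (scaled d) x \<le> scaled d x" for x
    unfolding avg_scaled unfolding scaled_def by (intro mult_left_mono stail_step(1) d) simp
  \<comment> \<open>The defect \<open>z\<close> of the overview is zero from \<open>c0\<close>
    on.\<close>
  have "\<forall>\<^sub>F x in at_top. scaled d x - T.avg (scaled d) x = 0"
    using eventually_ge_at_top[of c0]
  proof eventually_elim
    case (elim x)
    then show ?case unfolding avg_scaled stail_step(2)[OF d elim] by (simp add: scaled_def)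
  qed
  then have zlim: "((\<lambda>x. scaled d x - T.avg (scaled d) x) \<longlongrightarrow> 0) at_top"
    by (rule tendsto_eventually)
  have bot: "(scaled d \<longlongrightarrow> 0) at_bot"
  proof (rule Lim_null_comparison)
    show "\<forall>\<^sub>F x in at_bot. norm (scaled d x) \<le> exp (\<theta> * x)"
    proof (intro always_eventually allI)
      fix x
      show "norm (scaled d x) \<le> exp (\<theta> * x)"
        using mult_left_mono[OF stail_le_1[of d x], of "exp (\<theta> * x)"] scaled_nonneg[of d x] by (simp add: scaled_def)
    qed
    have "filterlim (\<lambda>x. \<theta> * x) at_bot at_bot"
      by (rule filterlim_tendsto_pos_mult_at_bot[OF tendsto_const theta filterlim_ident])
    then show "((\<lambda>x. exp (\<theta> * x)) \<longlongrightarrow> 0) at_bot" by (rule filterlim_compose[OF exp_at_bot])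
  qed
  have bd: "\<bar>scaled d x\<bar> \<le> exp (\<theta> * c0)" for x using scaled_nonneg[of d x] scaled_le[OF d, of x] by simp
  have int: "integrable tilt (\<lambda>x. x)"
    using integrable_exp_mult by (simp add: integral_tilt(1)[of "\<lambda>x. x", OF measurable_ident_sets[OF refl]])
  show ?thesis
    by (rule T.renewal_limit[OF scaled_lipschitz[OF d] bd bot step zlim ne nonlattice_tilt int tilt_mean_pos])
qed

theorem tail_limit: "\<exists>c>0. ((\<lambda>t. exp (\<theta> * t) * tail t) \<longlongrightarrow> c) at_top"
proof (rule tendsto_between_scaled[where h = scaled and C = "exp (\<theta> * c0)" and \<theta> = \<theta>])
  fix d t :: real assume d: "d > 0"
  show "\<exists>L>0. (scaled d \<longlongrightarrow> L) at_top" using d by (rule scaled_limit)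
  show "scaled d t \<le> exp (\<theta> * c0)" using d by (rule scaled_le)
  show "scaled d t \<le> exp (\<theta> * t) * tail t" using d by (rule scaled_le_tail)
  \<comment> \<open>The smoothing costs a shift of the level by \<open>d\<close>, which scaling
    turns into the factor \<open>exp (\<theta> * d)\<close>.\<close>
  show "exp (\<theta> * (t + d)) * tail (t + d) \<le> exp (\<theta> * d) * scaled d t"
    using mult_left_mono[OF tail_le_stail[OF d, of t], of "exp (\<theta> * (t + d))"]
    by (simp add: scaled_def distrib_left exp_add mult_ac)
qed

lemma tail_eq: "tail t = prob {\<omega> \<in> space M. perturbed_max X \<xi> \<omega> > ereal t}"
  unfolding tail_def perturbed_max_def by (simp add: less_SUP_iff pert_traj)

end

theorem theorem1:
  fixes M :: "'a measure"
    and X \<xi> :: "nat \<Rightarrow> 'a \<Rightarrow> real"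
    and \<theta>' \<epsilon> c0 :: real
  assumes "prob_space M"
    and "prob_space.iid_pairs_case M X \<xi> \<or> prob_space.indep_stationary_case M X \<xi>"
    and "\<theta>' > 0" and "\<epsilon> > 0"
    and "\<And>\<theta>. \<bar>\<theta> - \<theta>'\<bar> < \<epsilon> \<Longrightarrow> integrable M (\<lambda>\<omega>. exp (\<theta> * X 1 \<omega>))"
    and "prob_space.expectation M (\<lambda>\<omega>. exp (\<theta>' * X 1 \<omega>)) = 1"
    and "prob_space.nonlattice M (X 1)"
    and "measure M {\<omega> \<in> space M. X 1 \<omega> > c0} > 0"
    and "measure M {\<omega> \<in> space M. \<xi> 0 \<omega> \<le> c0} = 1"
  shows "\<exists>c>0. asymp_equiv
           (\<lambda>x::real. measure M {\<omega> \<in> space M. perturbed_max X \<xi> \<omega> > ereal x})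
           at_top
           (\<lambda>x. c * exp (- \<theta>' * x))"
proof -
  interpret prob_space M by fact
  note law = distr_pairs_split[OF assms(2)]
  have [measurable]: "\<xi> j \<in> borel_measurable M" for j by (rule law(3))
  have xi: "AE \<omega> in M. \<xi> 0 \<omega> \<le> c0"
  proof -
    have "AE \<omega> in M. \<omega> \<in> {\<omega> \<in> space M. \<xi> 0 \<omega> \<le> c0}"
      using assms(9) by (subst (asm) prob_eq_1) simp_all
    then show ?thesis by eventually_elim simp
  qed
  have int: "integrable M (\<lambda>\<omega>. exp (\<theta>' * X 1 \<omega>))" using assms(4) by (intro assms(5)) simp
  interpret cramer_walk M X \<xi> \<theta>' c0 \<epsilon>
    by unfold_locales (fact law xi int assms)+
  obtain c where c: "c > 0" "((\<lambda>t. exp (\<theta>' * t) * tail t) \<longlongrightarrow> c) at_top" using tail_limit by blast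
  have "((\<lambda>t. exp (\<theta>' * t) * tail t / c) \<longlongrightarrow> c / c) at_top"
    using c by (intro tendsto_divide tendsto_const) auto
  then have "((\<lambda>t. tail t / (c * exp (- \<theta>' * t))) \<longlongrightarrow> 1) at_top"
    using c(1) by (simp add: exp_minus field_simps)
  then have "tail \<sim>[at_top] (\<lambda>x. c * exp (- \<theta>' * x))" by (rule asymp_equivI')
  then show ?thesis using c(1) unfolding tail_eq[abs_def] by blast
qed

end
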